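(* Let $(\widetilde\gamma_t)_{t\ge0}\subseteq[0,1]$, let $0<\alpha<1$, and let $(x_0,\mathbf{a})\in\mathcal{X}\times\mathcal{A}$. Let $(X_t)_{t\ge0}$ and $(Q_t)_{t\ge0}$ be produced by the robust $Q$-learning algorithm described in the context, started from $x_0$, with policy $\mathbf{a}$, learning rates $(\widetilde\gamma_t)$ and an arbitrary initialization $Q_0:\mathcal{X}\times A\to\mathbb{R}$. For $(x,a)\in\mathcal{X}\times A$ and $t\ge0$ put $$N_t(x,a)=\sum_{s=0}^t\mathbf{1}_{\{(X_s,a_s(X_s))=(x,a)\}},\qquad \gamma_t(x,a,X_t)=\mathbf{1}_{\{(x,a)=(X_t,a_t(X_t))\}}\,\widetilde\gamma_{N_t(x,a)}.$$ Assume that $\mathbb{P}_{x_0,\mathbf{a}}$-almost surely $$\sum_{t=0}^\infty\gamma_t(x,a,X_t)=\infty,\qquad \sum_{t=0}^\infty\gamma_t^2(x,a,X_t)<\infty\qquad\text{for all }(x,a)\in\mathcal{X}\times A.$$ Then for all $(x,a)\in\mathcal{X}\times A$, $$\lim_{t\to\infty}Q_t(x,a)=Q^*(x,a)\qquad\mathbb{P}_{x_0,\mathbf{a}}\text{-almost surely}.$$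
   Context: **Robust control problem.** $\mathcal{X}\subset\mathbb{R}^d$, $A\subset\mathbb{R}^m$ are finite nonempty sets, $r:\mathcal{X}\times A\times\mathcal{X}\to\mathbb{R}$, $\alpha\in(0,1)$, $N\ge1$, and for each $(x,a)$, $\mathcal{P}(x,a)=\{\mathbb{P}^{(1)}(x,a),\dots,\mathbb{P}^{(N)}(x,a)\}$ is a finite set of probability measures on $\mathcal{X}$. Time is $t=0,1,2,\dots$; $\mathcal{A}$ is the set of policies $\mathbf{a}=(a_t)_{t\ge0}$ with $a_t:\mathcal{X}\to A$. For $x\in\mathcal{X}$, $\mathbf{a}\in\mathcal{A}$, $\mathfrak{P}_{x,\mathbf{a}}$ is the set of laws $\delta_x\otimes\mathbb{P}_0\otimes\mathbb{P}_1\otimes\cdots$ on $\mathcal{X}^{\mathbb{N}}$ ($X_0=x$, and $X_{t+1}$ has conditional law $\mathbb{P}_t(X_t)$ given $X_0,\dots,X_t$) with kernels $\mathbb{P}_t$ satisfying $\mathbb{P}_t(x_t)\in\mathcal{P}(x_t,a_t(x_t))$ for all $x_t\in\mathcal{X}$ and all $t$. The value function and robust optimal $Q$-function are $$V(x)=\sup_{\mathbf{a}\in\mathcal{A}}\inf_{\mathbb{P}\in\mathfrak{P}_{x,\mathbf{a}}}\mathbb{E}_{\mathbb{P}}\Big[\sum_{t=0}^\infty\alpha^tr(X_t,a_t(X_t),X_{t+1})\Big],\qquad Q^*(x,a)=\min_{\mathbb{P}\in\mathcal{P}(x,a)}\mathbb{E}_{\mathbb{P}}[r(x,a,X_1)+\alpha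 V(X_1)].$$ **Algorithm.** Set $X_0=x_0$, $Q_0$ arbitrary, and $\mathbb{P}^{(k)}_0(x,a)(y)=1/|\mathcal{X}|$ for all $k,x,a,y$. For $t=0,1,2,\dots$: 1. Choose $k_t^*\in\operatorname{argmin}_{k=1,\dots,N}\sum_{y\in\mathcal{X}}\big(r(X_t,a_t(X_t),y)+\alpha\max_{b\in A}Q_t(y,b)\big)\,\mathbb{P}^{(k)}_t(X_t,a_t(X_t))(y)$. 2. Sample, independently for $k=1,\dots,N$ (and independently of the past given $X_t$), $X^{(k)}_{t+1}\sim\mathbb{P}^{(k)}(X_t,a_t(X_t))$, and set $X_{t+1}=X_{t+1}^{(k_t^* )}$. 3. For all $k,x,a,y$ set $$\mathbb{P}^{(k)}_{t+1}(x,a)(y)=\frac{\sum_{s=0}^t\mathbf{1}_{\{(X_s,a_s(X_s),X^{(k)}_{s+1})=(x,a,y)\}}}{\sum_{s=0}^t\mathbf{1}_{\{(X_s,a_s(X_s))=(x,a)\}}}$$ (the initial value $1/|\mathcal{X}|$ being kept while $(x,a)$ has not been visited). 4. For all $(x,a)$ set $$Q_{t+1}(x,a)=(1-\gamma_t(x,a,X_t))Q_t(x,a)+\gamma_t(x,a,X_t)\big(r(x,a,X_{t+1})+\alpha\max_{b\in A}Q_t(X_{t+1},b)\big),$$ so only the entry $(x,a)=(X_t,a_t(X_t))$ changes. $\mathbb{P}_{x_0,\mathbf{a}}$ denotes the probability measure governing this process (so that, given the past up to time $t$, $X_{t+1}$ has law $\mathbb{P}^{(k_t^* )}(X_t,a_t(X_t))$).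 *)

theory Defs
  imports "HOL-Probability.Probability"
begin

section \<open>The robust control problem\<close>

text \<open>
  Probability measures on the finite set \<open>X\<close> are elements of
  \<open>space (prob_algebra (count_space X))\<close>. The measures generating the ambiguity sets are
  given by \<open>p k x b\<close> for \<open>k \<in> {1..N}\<close>, \<open>x \<in> X\<close>, \<open>b \<in> A\<close>.
\<close>

definition ambiguity_set :: "nat \<Rightarrow> (nat \<Rightarrow> 'x \<Rightarrow> 'a \<Rightarrow> 'x measure) \<Rightarrow> 'x \<Rightarrow> 'a \<Rightarrow> 'x measure set" where
  "ambiguity_set N p x b = (\<lambda>k. p k x b) ` {1..N}"

definition policies :: "'x set \<Rightarrow> 'a set \<Rightarrow> (nat \<Rightarrow> 'x \<Rightarrow> 'a) set" where
  "policies X A = {a. \<forall>t. a t \<in> X \<rightarrow> A}"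

text \<open>
  \<open>path_kernel\<close> is the transition from a history of length \<open>t\<close>, i.e. the coordinates \<open>0, \<dots>, t - 1\<close>,
  to coordinate \<open>t\<close>; \<open>path_law\<close> is the product \<open>\<delta>\<^sub>x \<otimes> K 0 \<otimes> K 1 \<otimes> \<dots>\<close> on \<open>X\<^sup>\<nat>\<close> given by the
  Ionescu-Tulcea theorem. The lemma \<open>emeasure_path_law\<close> below computes its
  finite-dimensional distributions.
\<close>

definition path_kernel :: "'x set \<Rightarrow> 'x \<Rightarrow> (nat \<Rightarrow> 'x \<Rightarrow> 'x measure) \<Rightarrow> nat \<Rightarrow> (nat \<Rightarrow> 'x) \<Rightarrow> 'x measure" where
  "path_kernel X x K t \<omega> = (case t of 0 \<Rightarrow> return (count_space X) x | Suc s \<Rightarrow> K s (\<omega> s))"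

definition path_law :: "'x set \<Rightarrow> 'x \<Rightarrow> (nat \<Rightarrow> 'x \<Rightarrow> 'x measure) \<Rightarrow> (nat \<Rightarrow> 'x) measure" where
  "path_law X x K =
     projective_family.lim UNIV
       (Ionescu_Tulcea.CI (path_kernel X x K) (\<lambda>_. count_space X)) (\<lambda>_. count_space X)"

definition path_laws ::
  "'x set \<Rightarrow> nat \<Rightarrow> (nat \<Rightarrow> 'x \<Rightarrow> 'a \<Rightarrow> 'x measure) \<Rightarrow> 'x \<Rightarrow> (nat \<Rightarrow> 'x \<Rightarrow> 'a) \<Rightarrow> (nat \<Rightarrow> 'x) measure set" where
  "path_laws X N p x a =
     {path_law X x K | K. \<forall>t. \<forall>y\<in>X. K t y \<in> ambiguity_set N p y (a t y)}"

text \<open>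
  For finite \<open>X\<close>, \<open>A\<close> and \<open>0 < \<alpha> < 1\<close> the expectations below are uniformly bounded, so the supremum
  and infimum in \<open>real\<close> are genuine.
\<close>

definition value_fn ::
  "'x set \<Rightarrow> 'a set \<Rightarrow> ('x \<Rightarrow> 'a \<Rightarrow> 'x \<Rightarrow> real) \<Rightarrow> real \<Rightarrow> nat \<Rightarrow> (nat \<Rightarrow> 'x \<Rightarrow> 'a \<Rightarrow> 'x measure) \<Rightarrow> 'x \<Rightarrow> real" where
  "value_fn X A r \<alpha> N p x =
     (SUP a\<in>policies X A. INF P\<in>path_laws X N p x a.
        \<integral>\<omega>. (\<Sum>t. \<alpha> ^ t * r (\<omega> t) (a t (\<omega> t)) (\<omega> (Suc t))) \<partial>P)"

definition robust_Q ::
  "'x set \<Rightarrow> 'a set \<Rightarrow> ('x \<Rightarrow> 'a \<Rightarrow> 'x \<Rightarrow> real) \<Rightarrow> real \<Rightarrow> nat \<Rightarrow> (nat \<Rightarrow> 'x \<Rightarrow> 'a \<Rightarrow> 'x measure) \<Rightarrow> 'x \<Rightarrow> 'a \<Rightarrow> real" where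
  "robust_Q X A r \<alpha> N p x b =
     Min ((\<lambda>P. \<integral>y. r x b y + \<alpha> * value_fn X A r \<alpha> N p y \<partial>P) ` ambiguity_set N p x b)"

lemma Ionescu_Tulcea_path_kernel:
  assumes x: "x \<in> X"
    and K: "\<And>t y. y \<in> X \<Longrightarrow> K t y \<in> space (prob_algebra (count_space X))"
  shows "Ionescu_Tulcea (path_kernel X x K) (\<lambda>_. count_space X)"
proof (rule Ionescu_Tulcea.intro)
  fix i :: nat
  show "path_kernel X x K i \<in> measurable (PiM {0..<i} (\<lambda>_. count_space X)) (subprob_algebra (count_space X))"
  proof (cases i)
    case 0
    have "prob_space (return (count_space X) x)"
      using x by (intro prob_space_return) simp
    then have "return (count_space X) x \<in> space (subprob_algebra (count_space X))"
      by (simp add: space_subprob_algebra prob_space_imp_subprob_space)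
    then show ?thesis by (simp add: path_kernel_def[abs_def] 0)
  next
    case (Suc s)
    have "K s \<in> measurable (count_space X) (subprob_algebra (count_space X))"
      using K by (auto simp: space_prob_algebra space_subprob_algebra prob_space_imp_subprob_space)
    moreover have "(\<lambda>\<omega>. \<omega> s) \<in> measurable (PiM {0..<i} (\<lambda>_. count_space X)) (count_space X)"
      using Suc by (intro measurable_component_singleton) simp
    ultimately have "(\<lambda>\<omega>. K s (\<omega> s)) \<in> measurable (PiM {0..<i} (\<lambda>_. count_space X)) (subprob_algebra (count_space X))"
      by (rule measurable_compose[rotated])
    then show ?thesis by (simp add: path_kernel_def[abs_def] Suc)
  qed
next
  fix i :: nat and \<omega> assume \<omega>: "\<omega> \<in> space (PiM {0..<i} (\<lambda>_. count_space X))"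
  show "prob_space (path_kernel X x K i \<omega>)"
  proof (cases i)
    case 0
    then show ?thesis using x by (simp add: path_kernel_def prob_space_return)
  next
    case (Suc s)
    then have "\<omega> s \<in> X" using \<omega> by (auto simp: space_PiM PiE_iff)
    then show ?thesis using K[of "\<omega> s" s] Suc by (simp add: path_kernel_def space_prob_algebra)
  qed
qed

lemma emeasure_path_law:
  assumes x: "x \<in> X"
    and K: "\<And>t y. y \<in> X \<Longrightarrow> K t y \<in> space (prob_algebra (count_space X))"
    and w: "\<And>i. w i \<in> X"
  shows "emeasure (path_law X x K) {\<omega> \<in> space (path_law X x K). \<forall>i\<le>n. \<omega> i = w i}
           = of_bool (w 0 = x) * (\<Prod>i<n. emeasure (K i (w i)) {w (Suc i)})"
proof -
  interpret IT: Ionescu_Tulcea "path_kernel X x K" "\<lambda>_. count_space X"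
    using x K by (rule Ionescu_Tulcea_path_kernel)
  let ?M = "\<lambda>n. PiM {0..<n} (\<lambda>_. count_space X)"
  let ?w = "\<lambda>n. restrict w {0..<n}"
  have w_sp: "?w n \<in> space (?M n)" for n using w by (auto simp: space_PiM)
  have sing: "{?w n} \<in> sets (?M n)" for n
  proof -
    have "{?w n} = PiE {0..<n} (\<lambda>i. {w i})"
      by (auto simp: PiE_iff extensional_def restrict_def fun_eq_iff)
    also have "\<dots> \<in> sets (?M n)"
      using w by (intro sets_PiM_I_finite) auto
    finally show ?thesis .
  qed
  have w_Suc: "fun_upd \<omega> n z = ?w (Suc n) \<longleftrightarrow> \<omega> = ?w n \<and> z = w n" if "\<omega> \<in> space (?M n)" for \<omega> n z
    using that by (auto simp: space_PiM PiE_iff extensional_def restrict_def fun_eq_iff)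
  have step: "emeasure (IT.C 0 (Suc n) (\<lambda>_. undefined)) {?w (Suc n)}
      = emeasure (IT.C 0 n (\<lambda>_. undefined)) {?w n} * emeasure (path_kernel X x K n (?w n)) {w n}" for n
  proof -
    have C: "space (IT.C 0 n (\<lambda>_. undefined)) = space (?M n)" "sets (IT.C 0 n (\<lambda>_. undefined)) = sets (?M n)"
      using IT.space_C[of "\<lambda>_. undefined" 0 n] IT.sets_C[of "\<lambda>_. undefined" 0 n] by (simp_all add: space_PiM)
    have ne: "space (IT.C 0 n (\<lambda>_. undefined)) \<noteq> {}"
      using w_sp[of n] unfolding C(1) by blast
    have "emeasure (IT.C 0 (Suc n) (\<lambda>_. undefined)) {?w (Suc n)}
        = (\<integral>\<^sup>+\<omega>. emeasure (IT.eP n \<omega>) {?w (Suc n)} \<partial>IT.C 0 n (\<lambda>_. undefined))"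
      using ne sing[of "Suc n"] IT.measurable_eP[of n]
      by (simp del: restrict_apply) (subst emeasure_bind[where N="?M (Suc n)"], auto simp: measurable_cong_sets[OF C(2) refl])
    also have "\<dots> = (\<integral>\<^sup>+\<omega>. emeasure (path_kernel X x K n (?w n)) {w n} * indicator {?w n} \<omega> \<partial>IT.C 0 n (\<lambda>_. undefined))"
    proof (rule nn_integral_cong)
      fix \<omega> assume "\<omega> \<in> space (IT.C 0 n (\<lambda>_. undefined))"
      then have \<omega>: "\<omega> \<in> space (?M n)" by (simp add: C)
      have "(\<lambda>z. fun_upd \<omega> n z) -` {?w (Suc n)} \<inter> space (count_space X) = (if \<omega> = ?w n then {w n} else {})"
        unfolding vimage_def singleton_iff w_Suc[OF \<omega>] using w[of n] by (auto simp del: restrict_apply)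
      then show "emeasure (IT.eP n \<omega>) {?w (Suc n)} = emeasure (path_kernel X x K n (?w n)) {w n} * indicator {?w n} \<omega>"
        using IT.emeasure_eP[OF \<omega> sing[of "Suc n"]] by (auto simp del: restrict_apply)
    qed
    also have "\<dots> = emeasure (IT.C 0 n (\<lambda>_. undefined)) {?w n} * emeasure (path_kernel X x K n (?w n)) {w n}"
      using sing[of n] by (subst nn_integral_cmult_indicator) (auto simp: C mult.commute)
    finally show ?thesis .
  qed
  have base: "emeasure (IT.C 0 0 (\<lambda>_. undefined)) {?w 0} = 1"
    using sing[of 0] by (simp add: restrict_def)
  have prod: "emeasure (IT.C 0 (Suc n) (\<lambda>_. undefined)) {?w (Suc n)}
      = of_bool (w 0 = x) * (\<Prod>i<n. emeasure (K i (w i)) {w (Suc i)})" for n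
  proof (induction n)
    case 0
    show ?case
      using w[of 0] unfolding step base by (simp add: path_kernel_def indicator_def)
  next
    case (Suc n)
    show ?case
      unfolding step[of "Suc n"] Suc.IH by (simp add: path_kernel_def mult.assoc)
  qed
  have sp: "space (path_law X x K) = space (PiM UNIV (\<lambda>_. count_space X))"
    by (simp add: path_law_def)
  have "{\<omega> \<in> space (path_law X x K). \<forall>i\<le>n. \<omega> i = w i} = IT.PF.emb UNIV {0..<Suc n} {?w (Suc n)}"
    unfolding sp by (auto simp: prod_emb_def space_PiM PiE_iff restrict_def fun_eq_iff less_Suc_eq_le)
      presburger
  then have "emeasure (path_law X x K) {\<omega> \<in> space (path_law X x K). \<forall>i\<le>n. \<omega> i = w i}
      = emeasure (IT.CI {0..<Suc n}) {?w (Suc n)}"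
    using IT.lim[OF _ sing[of "Suc n"]] by (simp add: path_law_def del: restrict_apply)
  also have "\<dots> = emeasure (IT.C 0 (Suc n) (\<lambda>_. undefined)) (IT.PF.emb {0..<Suc n} {0..<Suc n} {?w (Suc n)})"
    by (rule IT.emeasure_CI) (auto intro: sing)
  also have "IT.PF.emb {0..<Suc n} {0..<Suc n} {?w (Suc n)} = {?w (Suc n)}"
    using w_sp[of "Suc n"] by (intro prod_emb_id) (auto simp: space_PiM)
  finally show ?thesis using prod by simp
qed

section \<open>The robust Q-learning algorithm\<close>

text \<open>
  \<open>\<xi>\<close> is a realization of \<open>(X\<^sub>t)\<close>, and \<open>\<eta>\<close> one of \<open>(X\<^sup>(\<^sup>k\<^sup>)\<^sub>t)\<close> for a single \<open>k\<close>, of which only the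
  entries with \<open>t \<ge> 1\<close> are used. The policy is \<open>a\<close> and \<open>g\<close> is the sequence \<open>(\<gamma>~\<^sub>n)\<close>.
\<close>

definition visits :: "(nat \<Rightarrow> 'x \<Rightarrow> 'a) \<Rightarrow> (nat \<Rightarrow> 'x) \<Rightarrow> nat \<Rightarrow> 'x \<Rightarrow> 'a \<Rightarrow> nat" where
  "visits a \<xi> t x b = (\<Sum>s\<le>t. of_bool ((\<xi> s, a s (\<xi> s)) = (x, b)))"

definition learning_rate ::
  "(nat \<Rightarrow> 'x \<Rightarrow> 'a) \<Rightarrow> (nat \<Rightarrow> real) \<Rightarrow> (nat \<Rightarrow> 'x) \<Rightarrow> nat \<Rightarrow> 'x \<Rightarrow> 'a \<Rightarrow> real" where
  "learning_rate a g \<xi> t x b = of_bool ((x, b) = (\<xi> t, a t (\<xi> t))) * g (visits a \<xi> t x b)"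

primrec Q_iter ::
  "'a set \<Rightarrow> ('x \<Rightarrow> 'a \<Rightarrow> 'x \<Rightarrow> real) \<Rightarrow> real \<Rightarrow> (nat \<Rightarrow> 'x \<Rightarrow> 'a) \<Rightarrow> (nat \<Rightarrow> real) \<Rightarrow> ('x \<Rightarrow> 'a \<Rightarrow> real)
     \<Rightarrow> (nat \<Rightarrow> 'x) \<Rightarrow> nat \<Rightarrow> 'x \<Rightarrow> 'a \<Rightarrow> real" where
  "Q_iter A r \<alpha> a g Q0 \<xi> 0 = Q0"
| "Q_iter A r \<alpha> a g Q0 \<xi> (Suc t) = (\<lambda>x b.
     (1 - learning_rate a g \<xi> t x b) * Q_iter A r \<alpha> a g Q0 \<xi> t x b
     + learning_rate a g \<xi> t x b *
         (r x b (\<xi> (Suc t)) + \<alpha> * Max ((\<lambda>c. Q_iter A r \<alpha> a g Q0 \<xi> t (\<xi> (Suc t)) c) ` A)))"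

text \<open>The empirical estimate of the \<open>k\<close>-th kernel at time \<open>t\<close>, as a weight function of \<open>y\<close>.\<close>

primrec empirical ::
  "'x set \<Rightarrow> (nat \<Rightarrow> 'x \<Rightarrow> 'a) \<Rightarrow> (nat \<Rightarrow> 'x) \<Rightarrow> (nat \<Rightarrow> 'x) \<Rightarrow> nat \<Rightarrow> 'x \<Rightarrow> 'a \<Rightarrow> 'x \<Rightarrow> real" where
  "empirical X a \<xi> \<eta> 0 = (\<lambda>x b y. 1 / real (card X))"
| "empirical X a \<xi> \<eta> (Suc t) = (\<lambda>x b y.
     if visits a \<xi> t x b = 0 then empirical X a \<xi> \<eta> t x b y
     else (\<Sum>s\<le>t. of_bool ((\<xi> s, a s (\<xi> s), \<eta> (Suc s)) = (x, b, y))) / real (visits a \<xi> t x b))"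

text \<open>
  The objective minimized over \<open>k\<close> in the selection of the kernel; \<open>q\<close> is the current iterate
  and \<open>w\<close> the estimated weights at the current state-action pair \<open>(x, b)\<close>.
\<close>

definition selection_cost ::
  "'x set \<Rightarrow> 'a set \<Rightarrow> ('x \<Rightarrow> 'a \<Rightarrow> 'x \<Rightarrow> real) \<Rightarrow> real \<Rightarrow> ('x \<Rightarrow> 'a \<Rightarrow> real) \<Rightarrow> 'x \<Rightarrow> 'a \<Rightarrow> ('x \<Rightarrow> real) \<Rightarrow> real" where
  "selection_cost X A r \<alpha> q x b w = (\<Sum>y\<in>X. (r x b y + \<alpha> * Max ((\<lambda>c. q y c) ` A)) * w y)"

text \<open>
  The \<open>\<sigma>\<close>-algebra of the past at the moment when the samples for time \<open>t + 1\<close> are drawn. It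
  includes the selected index \<open>\<kappa> t\<close>, so ties may be broken in any non-anticipating way.
\<close>

definition past ::
  "'w measure \<Rightarrow> nat \<Rightarrow> (nat \<Rightarrow> 'w \<Rightarrow> 'x) \<Rightarrow> (nat \<Rightarrow> nat \<Rightarrow> 'w \<Rightarrow> 'x) \<Rightarrow> (nat \<Rightarrow> 'w \<Rightarrow> nat) \<Rightarrow> nat \<Rightarrow> 'w measure" where
  "past M N Xs Y \<kappa> t = sigma (space M)
     ({Xs s -` {y} \<inter> space M | s y. s \<le> t}
      \<union> {Y k s -` {y} \<inter> space M | k s y. k \<in> {1..N} \<and> s \<in> {1..t}}
      \<union> {\<kappa> s -` {k} \<inter> space M | s k. s \<le> t})"

text \<open>
  A run of the algorithm on an arbitrary probability space \<open>M\<close>: \<open>Xs t\<close> is \<open>X\<^sub>t\<close>, \<open>Y k t\<close> is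
  \<open>X\<^sup>(\<^sup>k\<^sup>)\<^sub>t\<close> and \<open>\<kappa> t\<close> is the selected index \<open>k\<^sub>t\<^sup>*\<close>. The last clause says that,
  conditionally on the past, the samples \<open>Y k (Suc t)\<close> are independent
  over \<open>k\<close> with laws \<open>p k (X\<^sub>t) (a\<^sub>t (X\<^sub>t))\<close>.
\<close>

definition robust_Q_learning ::
  "'x set \<Rightarrow> 'a set \<Rightarrow> ('x \<Rightarrow> 'a \<Rightarrow> 'x \<Rightarrow> real) \<Rightarrow> real \<Rightarrow> nat \<Rightarrow> (nat \<Rightarrow> 'x \<Rightarrow> 'a \<Rightarrow> 'x measure)
     \<Rightarrow> 'x \<Rightarrow> (nat \<Rightarrow> 'x \<Rightarrow> 'a) \<Rightarrow> (nat \<Rightarrow> real) \<Rightarrow> ('x \<Rightarrow> 'a \<Rightarrow> real)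
     \<Rightarrow> 'w measure \<Rightarrow> (nat \<Rightarrow> 'w \<Rightarrow> 'x) \<Rightarrow> (nat \<Rightarrow> nat \<Rightarrow> 'w \<Rightarrow> 'x) \<Rightarrow> (nat \<Rightarrow> 'w \<Rightarrow> nat) \<Rightarrow> bool" where
  "robust_Q_learning X A r \<alpha> N p x0 a g Q0 M Xs Y \<kappa> \<longleftrightarrow>
     prob_space M
     \<and> (\<forall>k\<in>{1..N}. \<forall>t. Y k (Suc t) \<in> measurable M (count_space X))
     \<and> (\<forall>t. \<kappa> t \<in> measurable M (count_space {1..N}))
     \<and> (\<forall>\<omega>\<in>space M. Xs 0 \<omega> = x0)
     \<and> (\<forall>t. \<forall>\<omega>\<in>space M. Xs (Suc t) \<omega> = Y (\<kappa> t \<omega>) (Suc t) \<omega>)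
     \<and> (\<forall>t. \<forall>\<omega>\<in>space M.
          is_arg_min
            (\<lambda>k. selection_cost X A r \<alpha> (Q_iter A r \<alpha> a g Q0 (\<lambda>s. Xs s \<omega>) t)
                   (Xs t \<omega>) (a t (Xs t \<omega>))
                   (empirical X a (\<lambda>s. Xs s \<omega>) (\<lambda>s. Y k s \<omega>) t (Xs t \<omega>) (a t (Xs t \<omega>))))
            (\<lambda>k. k \<in> {1..N}) (\<kappa> t \<omega>))
     \<and> (\<forall>t. \<forall>y\<in>{1..N} \<rightarrow> X. AE \<omega> in M.
          real_cond_exp M (past M N Xs Y \<kappa> t)
              (indicator {\<omega> \<in> space M. \<forall>k\<in>{1..N}. Y k (Suc t) \<omega> = y k}) \<omega>
            = (\<Prod>k\<in>{1..N}. measure (p k (Xs t \<omega>) (a t (Xs t \<omega>))) {y k}))"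

end

theory Submission
  imports Defs
begin

text \<open>
  The update target of \<open>Q\<^sub>t\<close> splits into the robust Bellman operator applied to \<open>Q\<^sub>t\<close>, a martingale
  increment, and the error of selecting the kernel from empirical estimates. A pair with divergent
  rates is visited infinitely often, so the estimates are consistent and, the iterates being bounded,
  the selection error vanishes. The rates are square summable along the visits, so the series of
  increments converges almost surely by Kolmogorov's maximal inequality. What remains is a relaxation
  towards a sup-norm contraction, argued path by path: a bound \<open>B\<close> on the distance to the fixed
  point improves to \<open>B (1 + \<alpha>) / 2\<close> after finite time. The fixed point is \<open>robust_Q\<close>, because
  the maximum over actions of any fixed point satisfies the dynamic programming equation of \<open>value_fn\<close>.
\<close>

section \<open>Relaxation schemes\<close>

text \<open>The difficulty is that the law of the next state depends on an index chosen from noisy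
  estimates. The increment is therefore centred at the kernel actually selected, whose index
  \<open>past\<close> already knows, and the gap to the minimizing kernel becomes a separate error
  that need only tend to 0. The samples entering an estimate arrive at random visit times. No law of
  large numbers is invoked for them: an empirical mean is itself a relaxation with rate
  \<open>1 / n\<close> at the n-th visit, so the martingale bound and the noise lemma that treat Q
  also give consistency. Both uses rest on the rate being a fixed sequence read off at the visit
  number. This turns an almost sure statement about random series into a deterministic one and
  bounds second moments uniformly over paths. The factor (1 + \<alpha>) / 2 is halfway between
  \<alpha> and 1: the gap above \<alpha> absorbs the vanishing errors, the gap below 1 gives
  geometric decay.\<close>

lemma relaxation_eventually_le:
  fixes u \<gamma> :: "nat \<Rightarrow> real"
  assumes \<gamma>: "\<And>n. 0 \<le> \<gamma> n" "\<And>n. \<gamma> n \<le> 1" "\<not> summable \<gamma>"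
    and step: "\<forall>\<^sub>F n in sequentially. u (Suc n) \<le> (1 - \<gamma> n) * u n + \<gamma> n * c"
    and "c < d"
  shows "\<forall>\<^sub>F n in sequentially. u n \<le> d"
proof -
  obtain n0 where n0: "\<And>n. n \<ge> n0 \<Longrightarrow> u (Suc n) \<le> (1 - \<gamma> n) * u n + \<gamma> n * c"
    using step by (auto simp: eventually_sequentially)
  \<comment> \<open>As long as \<open>u\<close> stays above \<open>d\<close>, each step lowers it by
    at least \<open>\<gamma> n * (d - c)\<close>; with divergent rates the total decrease would be
    infinite.\<close>
  have "\<exists>m\<ge>n0. u m \<le> d"
  proof (rule ccontr)
    assume "\<not> ?thesis"
    then have gt: "u m > d" if "m \<ge> n0" for m using that by force
    have dec: "u (Suc n) \<le> u n - \<gamma> n * (d - c)" if "n \<ge> n0" for n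
    proof -
      have "\<gamma> n * d \<le> \<gamma> n * u n" using gt[OF that] \<gamma>(1)[of n] by (intro mult_left_mono) auto
      then show ?thesis using n0[OF that] by (simp add: algebra_simps)
    qed
    have tot: "u (n0 + n) \<le> u n0 - (\<Sum>i<n. \<gamma> (i + n0)) * (d - c)" for n
    proof (induction n)
      case (Suc n)
      show ?case using dec[of "n0 + n"] Suc by (simp add: algebra_simps)
    qed simp
    have "(\<Sum>i<n. \<gamma> (i + n0)) \<le> (u n0 - d) / (d - c)" for n
      using tot[of n] gt[of "n0 + n"] \<open>c < d\<close> by (simp add: field_simps)
    then have "summable (\<lambda>i. \<gamma> (i + n0))"
      by (intro summableI_nonneg_bounded[where x="(u n0 - d) / (d - c)"] \<gamma>)
    with \<gamma>(3) show False by (simp add: summable_iff_shift)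
  qed
  then obtain m where m: "m \<ge> n0" "u m \<le> d" by blast
  \<comment> \<open>The level \<open>d\<close> is absorbing: the next value is at most a convex
    combination of two numbers not exceeding \<open>d\<close>.\<close>
  have "u n \<le> d" if "n \<ge> m" for n
    using that
  proof (induction n rule: dec_induct)
    case (step n)
    have "u (Suc n) \<le> (1 - \<gamma> n) * u n + \<gamma> n * c" using n0 m step by simp
    also have "\<dots> \<le> (1 - \<gamma> n) * d + \<gamma> n * d"
      using step \<open>c < d\<close> \<gamma>(1,2)[of n] by (intro add_mono mult_left_mono) auto
    finally show ?case by (simp add: algebra_simps)
  qed (fact m)
  then show ?thesis by (auto simp: eventually_sequentially)
qed

lemma relaxation_eventually_abs_le:
  fixes u f \<gamma> :: "nat \<Rightarrow> real"
  assumes \<gamma>: "\<And>n. 0 \<le> \<gamma> n" "\<And>n. \<gamma> n \<le> 1" "\<not> summable \<gamma>"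
    and step: "\<And>n. u (Suc n) = (1 - \<gamma> n) * u n + \<gamma> n * f n"
    and f: "\<forall>\<^sub>F n in sequentially. \<bar>f n\<bar> \<le> c"
    and "c < d"
  shows "\<forall>\<^sub>F n in sequentially. \<bar>u n\<bar> \<le> d"
proof -
  have "\<forall>\<^sub>F n in sequentially. u (Suc n) \<le> (1 - \<gamma> n) * u n + \<gamma> n * c"
    using f by eventually_elim (auto simp: step intro!: mult_left_mono \<gamma>)
  note 1 = relaxation_eventually_le[OF \<gamma> this \<open>c < d\<close>]
  have "\<forall>\<^sub>F n in sequentially. - u (Suc n) \<le> (1 - \<gamma> n) * (- u n) + \<gamma> n * c"
    using f
  proof eventually_elim
    case (elim n)
    then have "\<gamma> n * (- f n) \<le> \<gamma> n * c" by (intro mult_left_mono \<gamma>) auto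
    then show ?case by (simp add: step algebra_simps)
  qed
  note 2 = relaxation_eventually_le[OF \<gamma> this \<open>c < d\<close>]
  show ?thesis using 1 2 by eventually_elim auto
qed

lemma relaxation_tendsto_0:
  fixes u e \<gamma> :: "nat \<Rightarrow> real"
  assumes \<gamma>: "\<And>n. 0 \<le> \<gamma> n" "\<And>n. \<gamma> n \<le> 1" "\<not> summable \<gamma>"
    and step: "\<And>n. u (Suc n) = (1 - \<gamma> n) * u n + \<gamma> n * e n"
    and e: "e \<longlonglongrightarrow> 0"
  shows "u \<longlonglongrightarrow> 0"
proof (rule tendstoI)
  fix \<epsilon> :: real assume "\<epsilon> > 0"
  have "\<forall>\<^sub>F n in sequentially. \<bar>e n\<bar> \<le> \<epsilon> / 3"
    using tendstoD[OF e, of "\<epsilon> / 3"] \<open>\<epsilon> > 0\<close> by (auto elim: eventually_mono)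
  \<comment> \<open>Strict room is needed twice: between the bound on the error and the bound on
    \<open>u\<close>, and between that one and \<open>\<epsilon>\<close>.\<close>
  from relaxation_eventually_abs_le[OF \<gamma> step this, of "\<epsilon> / 2"] \<open>\<epsilon> > 0\<close>
  show "\<forall>\<^sub>F n in sequentially. dist (u n) 0 < \<epsilon>"
    by (auto elim: eventually_mono)
qed

text \<open>Subtracting the tail of the convergent series turns the noise into an error tending to \<open>0\<close>.\<close>

lemma relaxation_noise_tendsto_0:
  fixes u \<xi> \<gamma> :: "nat \<Rightarrow> real"
  assumes \<gamma>: "\<And>n. 0 \<le> \<gamma> n" "\<And>n. \<gamma> n \<le> 1" "\<not> summable \<gamma>"
    and step: "\<And>n. u (Suc n) = (1 - \<gamma> n) * u n + \<gamma> n * \<xi> n"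
    and \<xi>: "convergent (\<lambda>n. \<Sum>i<n. \<gamma> i * \<xi> i)"
  shows "u \<longlonglongrightarrow> 0"
proof -
  obtain S where S: "(\<lambda>n. \<Sum>i<n. \<gamma> i * \<xi> i) \<longlonglongrightarrow> S" using \<xi> by (auto simp: convergent_def)
  define R where "R n = (\<Sum>i<n. \<gamma> i * \<xi> i) - S" for n
  have R: "R \<longlonglongrightarrow> 0" unfolding R_def[abs_def] using tendsto_diff[OF S tendsto_const[of S]] by simp
  have "(\<lambda>n. u n - R n) \<longlonglongrightarrow> 0"
  proof (rule relaxation_tendsto_0[OF \<gamma>])
    show "u (Suc n) - R (Suc n) = (1 - \<gamma> n) * (u n - R n) + \<gamma> n * (- R n)" for n
      by (simp add: step R_def algebra_simps)
    show "(\<lambda>n. - R n) \<longlonglongrightarrow> 0" using tendsto_minus[OF R] by simp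
  qed
  from tendsto_add[OF this R] show ?thesis by simp
qed

text \<open>The coordinates have their own rates and so improve at different speeds, but a bound
  \<open>B\<close> on all of them bounds every input by about \<alpha> B. Each coordinate then falls
  below a slightly larger level for good, and since \<open>S\<close> is finite there is a common
  time after which all have done so. Iterating gives a geometric sequence of eventual
  bounds.\<close>

lemma relaxation_contraction_tendsto_0:
  fixes z f \<gamma> :: "nat \<Rightarrow> 's \<Rightarrow> real"
  assumes S: "finite S"
    and \<alpha>: "0 \<le> \<alpha>" "\<alpha> < 1"
    and \<gamma>: "\<And>n s. s \<in> S \<Longrightarrow> 0 \<le> \<gamma> n s" "\<And>n s. s \<in> S \<Longrightarrow> \<gamma> n s \<le> 1"
      "\<And>s. s \<in> S \<Longrightarrow> \<not> summable (\<lambda>n. \<gamma> n s)"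
    and step: "\<And>n s. s \<in> S \<Longrightarrow> z (Suc n) s = (1 - \<gamma> n s) * z n s + \<gamma> n s * f n s"
    and f: "\<And>n s B. s \<in> S \<Longrightarrow> (\<And>s'. s' \<in> S \<Longrightarrow> \<bar>z n s'\<bar> \<le> B) \<Longrightarrow> \<bar>f n s\<bar> \<le> \<alpha> * B + e n"
    and e: "e \<longlonglongrightarrow> 0"
    and bounded: "\<And>n s. s \<in> S \<Longrightarrow> \<bar>z n s\<bar> \<le> B0"
    and s: "s \<in> S"
  shows "(\<lambda>n. z n s) \<longlonglongrightarrow> 0"
proof -
  define \<beta> where "\<beta> = (1 + \<alpha>) / 2"
  have \<beta>: "0 < \<beta>" "\<beta> < 1" using \<alpha> by (auto simp: \<beta>_def)
  have shrink: "\<forall>\<^sub>F n in sequentially. \<forall>s\<in>S. \<bar>z n s\<bar> \<le> \<beta> * B"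
    if B: "B > 0" and ev: "\<forall>\<^sub>F n in sequentially. \<forall>s\<in>S. \<bar>z n s\<bar> \<le> B" for B
  proof (intro eventually_ball_finite S ballI)
    fix s assume s: "s \<in> S"
    \<comment> \<open>Since \<beta> - \<alpha> = (1 - \<alpha>) / 2, half of this gap is granted to
      the error \<open>e n\<close>; the other half provides the strict inequality for the
      relaxation.\<close>
    have pos: "(1 - \<alpha>) / 4 * B > 0" using \<alpha> B by simp
    have "\<forall>\<^sub>F n in sequentially. \<bar>f n s\<bar> \<le> \<alpha> * B + (1 - \<alpha>) / 4 * B"
      using ev tendstoD[OF e pos]
    proof eventually_elim
      case (elim n)
      have "\<bar>f n s\<bar> \<le> \<alpha> * B + e n" using elim by (intro f s) auto
      with elim show ?case by simp
    qed
    then show "\<forall>\<^sub>F n in sequentially. \<bar>z n s\<bar> \<le> \<beta> * B"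
    proof (rule relaxation_eventually_abs_le[of "\<lambda>n. \<gamma> n s" "\<lambda>n. z n s" "\<lambda>n. f n s", rotated 4])
      show "\<alpha> * B + (1 - \<alpha>) / 4 * B < \<beta> * B" using pos by (simp add: \<beta>_def field_simps)
    qed (use \<gamma> step s in auto)
  qed
  \<comment> \<open>The maximum with 1 makes the starting bound positive, as \<open>shrink\<close>
    requires.\<close>
  define B where "B = max B0 1"
  have iter: "\<forall>\<^sub>F n in sequentially. \<forall>s\<in>S. \<bar>z n s\<bar> \<le> \<beta> ^ k * B" for k
  proof (induction k)
    case 0
    have "\<bar>z n s\<bar> \<le> B" if "s \<in> S" for n s
      using bounded[OF that, of n] by (simp add: B_def)
    then show ?case by simp
  next
    case (Suc k)
    have "\<beta> ^ k * B > 0" using \<beta> by (simp add: B_def)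
    from shrink[OF this Suc] show ?case by (simp add: mult.assoc)
  qed
  show ?thesis
  proof (rule tendstoI)
    fix \<epsilon> :: real assume "\<epsilon> > 0"
    have "(\<lambda>k. \<beta> ^ k * B) \<longlonglongrightarrow> 0"
      using \<beta> by (auto intro!: tendsto_mult_left_zero LIMSEQ_realpow_zero)
    from order_tendstoD(2)[OF this \<open>\<epsilon> > 0\<close>] obtain k where k: "\<beta> ^ k * B < \<epsilon>"
      by (auto simp: eventually_sequentially)
    show "\<forall>\<^sub>F n in sequentially. dist (z n s) 0 < \<epsilon>"
      using iter[of k] by eventually_elim (use k s in force)
  qed
qed

text \<open>By linearity the noise can be split off into a process \<open>W\<close> with the same
  rates that starts at 0 and is driven by \<open>\<xi>\<close> alone. Then
  \<open>\<Delta> - W\<close> follows a noise-free recursion. There \<open>F\<close> still sees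
  \<open>\<Delta>\<close> instead of \<open>\<Delta> - W\<close>, which costs at most \<alpha> times
  the size of \<open>W\<close>, again an error tending to 0.\<close>

lemma stochastic_approximation_tendsto_0:
  fixes \<Delta> F \<xi> e \<gamma> :: "nat \<Rightarrow> 's \<Rightarrow> real"
  assumes S: "finite S"
    and \<alpha>: "0 \<le> \<alpha>" "\<alpha> < 1"
    and \<gamma>: "\<And>n s. s \<in> S \<Longrightarrow> 0 \<le> \<gamma> n s" "\<And>n s. s \<in> S \<Longrightarrow> \<gamma> n s \<le> 1"
      "\<And>s. s \<in> S \<Longrightarrow> \<not> summable (\<lambda>n. \<gamma> n s)"
    and step: "\<And>n s. s \<in> S \<Longrightarrow>
      \<Delta> (Suc n) s = (1 - \<gamma> n s) * \<Delta> n s + \<gamma> n s * (F n s + \<xi> n s + e n s)"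
    and F: "\<And>n s B. s \<in> S \<Longrightarrow> (\<And>s'. s' \<in> S \<Longrightarrow> \<bar>\<Delta> n s'\<bar> \<le> B) \<Longrightarrow> \<bar>F n s\<bar> \<le> \<alpha> * B"
    and \<xi>: "\<And>s. s \<in> S \<Longrightarrow> convergent (\<lambda>n. \<Sum>i<n. \<gamma> i s * \<xi> i s)"
    and e: "\<And>s. s \<in> S \<Longrightarrow> (\<lambda>n. e n s) \<longlonglongrightarrow> 0"
    and bounded: "\<And>n s. s \<in> S \<Longrightarrow> \<bar>\<Delta> n s\<bar> \<le> B0"
    and s: "s \<in> S"
  shows "(\<lambda>n. \<Delta> n s) \<longlonglongrightarrow> 0"
proof -
  define W where "W = rec_nat (\<lambda>_. 0) (\<lambda>n w s. (1 - \<gamma> n s) * w s + \<gamma> n s * \<xi> n s)"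
  have W_Suc: "W (Suc n) s = (1 - \<gamma> n s) * W n s + \<gamma> n s * \<xi> n s" for n s
    by (simp add: W_def)
  have W: "(\<lambda>n. W n s) \<longlonglongrightarrow> 0" if "s \<in> S" for s
    using that \<gamma> \<xi> by (intro relaxation_noise_tendsto_0[of "\<lambda>n. \<gamma> n s" _ "\<lambda>n. \<xi> n s"]) (auto simp: W_Suc)
  define w where "w n = (\<Sum>s\<in>S. \<bar>W n s\<bar>)" for n
  have w: "\<bar>W n s\<bar> \<le> w n" if "s \<in> S" for n s
    unfolding w_def using S that by (intro member_le_sum) auto
  have w_lim: "w \<longlonglongrightarrow> 0"
    unfolding w_def using W by (auto intro!: tendsto_null_sum tendsto_rabs_zero)
  \<comment> \<open>The contraction lemma asks for a bounded process; for the part \<open>W\<close>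
    this comes from its convergence.\<close>
  then obtain B1 where B1: "\<And>n. \<bar>w n\<bar> \<le> B1"
    by (metis Bseq_def convergentI convergent_imp_Bseq real_norm_def)
  define e' where "e' n = \<alpha> * w n + (\<Sum>s\<in>S. \<bar>e n s\<bar>)" for n
  have e'_lim: "e' \<longlonglongrightarrow> 0"
    unfolding e'_def
    using e by (intro tendsto_add_zero tendsto_mult_right_zero w_lim tendsto_null_sum tendsto_rabs_zero)
  have "(\<lambda>n. \<Delta> n s - W n s) \<longlonglongrightarrow> 0"
  proof (rule relaxation_contraction_tendsto_0[OF S \<alpha> \<gamma>, where f="\<lambda>n s. F n s + e n s" and e=e' and ?B0.0="B0 + B1"])
    fix n s assume s: "s \<in> S"
    show "\<Delta> (Suc n) s - W (Suc n) s = (1 - \<gamma> n s) * (\<Delta> n s - W n s) + \<gamma> n s * (F n s + e n s)"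
      using s by (simp add: step W_Suc algebra_simps)
    show "\<bar>\<Delta> n s - W n s\<bar> \<le> B0 + B1"
      using bounded[OF s, of n] w[OF s, of n] B1[of n] by linarith
    fix B assume B: "\<And>s'. s' \<in> S \<Longrightarrow> \<bar>\<Delta> n s' - W n s'\<bar> \<le> B"
    have "\<bar>F n s\<bar> \<le> \<alpha> * (B + w n)"
    proof (rule F[OF s])
      fix s' assume "s' \<in> S"
      with B[of s'] w[of s' n] show "\<bar>\<Delta> n s'\<bar> \<le> B + w n" by linarith
    qed
    moreover have "\<bar>e n s\<bar> \<le> (\<Sum>s\<in>S. \<bar>e n s\<bar>)"
      using S s by (intro member_le_sum) auto
    ultimately show "\<bar>F n s + e n s\<bar> \<le> \<alpha> * B + e' n"
      unfolding e'_def by (simp add: distrib_left)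
  qed (use s e'_lim in auto)
  from tendsto_add[OF this W[OF s]] show ?thesis by simp
qed

section \<open>Martingales with square-summable increments\<close>

context prob_space
begin

text \<open>The martingale property is stated as orthogonality of \<open>D n\<close> to all bounded
  \<open>F n\<close>-measurable functions. This is the form in which the second-moment argument uses
  it, and it can be verified by computing plain expectations.\<close>

context
  fixes F :: "nat \<Rightarrow> 'a measure" and D :: "nat \<Rightarrow> 'a \<Rightarrow> real" and c :: real
  assumes F: "\<And>n. subalgebra M (F n)" and F_Suc: "\<And>n. sets (F n) \<subseteq> sets (F (Suc n))"
    and D_meas: "\<And>n. D n \<in> borel_measurable (F (Suc n))"
    and D_bound: "\<And>n \<omega>. \<omega> \<in> space M \<Longrightarrow> \<bar>D n \<omega>\<bar> \<le> c"
    and D_orth: "\<And>n G b. G \<in> borel_measurable (F n) \<Longrightarrow> (\<And>\<omega>. \<omega> \<in> space M \<Longrightarrow> \<bar>G \<omega>\<bar> \<le> b)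
        \<Longrightarrow> expectation (\<lambda>\<omega>. G \<omega> * D n \<omega>) = 0"
begin

lemma adapted_mono: "m \<le> n \<Longrightarrow> f \<in> borel_measurable (F m) \<Longrightarrow> f \<in> borel_measurable (F n)"
proof -
  assume "m \<le> n" and f: "f \<in> borel_measurable (F m)"
  have "sets (F m) \<subseteq> sets (F n)" by (rule lift_Suc_mono_le[of "\<lambda>n. sets (F n)", OF F_Suc \<open>m \<le> n\<close>])
  then have "subalgebra (F n) (F m)" using F[of n] F[of m] by (simp add: subalgebra_def)
  with f show ?thesis by (rule measurable_from_subalg[rotated])
qed

lemma increment_adapted: "i < n \<Longrightarrow> D i \<in> borel_measurable (F n)"
  using adapted_mono[OF _ D_meas] by auto

lemma increment_measurable: "D i \<in> borel_measurable M"
  using D_meas F measurable_from_subalg by blast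

lemma increment_bound_nonneg: "0 \<le> c"
  using D_bound not_empty by fastforce

text \<open>
  Kolmogorov's maximal inequality, by applying Chebyshev's inequality to the martingale stopped
  when it first leaves the interval of radius \<open>\<epsilon>\<close>.
\<close>

lemma maximal_inequality_finite:
  fixes \<epsilon> :: real and m n :: nat
  assumes "\<epsilon> > 0"
  shows "prob {\<omega> \<in> space M. \<exists>j\<in>{m..n}. \<epsilon> \<le> \<bar>\<Sum>i=m..<j. D i \<omega>\<bar>} \<le> (\<Sum>i=m..<n. expectation (\<lambda>\<omega>. (D i \<omega>)\<^sup>2)) / \<epsilon>\<^sup>2"
proof -
  note [measurable] = increment_measurable
  \<comment> \<open>\<open>H i\<close> indicates that the level has not been reached by any partial
    sum up to index \<open>i\<close>. The sum ending at \<open>j\<close> uses only increments before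
    \<open>j\<close>, so \<open>H i\<close> is \<open>F i\<close>-measurable while
    \<open>D i\<close> is the next increment: \<open>T\<close> is the stopped martingale.\<close>
  define H where "H i \<omega> = (of_bool (\<forall>j\<in>{m..i}. \<bar>\<Sum>i=m..<j. D i \<omega>\<bar> < \<epsilon>) :: real)" for i \<omega>
  define T where "T n \<omega> = (\<Sum>i=m..<n. H i \<omega> * D i \<omega>)" for n \<omega>
  have H_F: "H i \<in> borel_measurable (F i)" for i
  proof -
    have [measurable]: "(\<lambda>\<omega>. \<Sum>i=m..<j. D i \<omega>) \<in> borel_measurable (F i)" if "j \<in> {m..i}" for j
      using that by (intro borel_measurable_sum increment_adapted) auto
    show ?thesis unfolding H_def[abs_def] of_bool_def by measurable
  qed
  have T_F: "T n \<in> borel_measurable (F n)" for n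
    unfolding T_def[abs_def]
    by (intro borel_measurable_sum borel_measurable_times increment_adapted adapted_mono[OF _ H_F]) auto
  have [measurable]: "H i \<in> borel_measurable M" "T i \<in> borel_measurable M" for i
    using H_F[of i] T_F[of i] F[of i] measurable_from_subalg by blast+
  have H01: "0 \<le> H i \<omega>" "H i \<omega> \<le> 1" "H i \<omega> * H i \<omega> = H i \<omega>" for i \<omega> by (auto simp: H_def)
  have T_bound: "\<bar>T n \<omega>\<bar> \<le> n * c" if "\<omega> \<in> space M" for n \<omega>
  proof -
    have "\<bar>T n \<omega>\<bar> \<le> (\<Sum>i=m..<n. c)"
      unfolding T_def using H01 D_bound[OF that]
      by (intro order_trans[OF sum_abs] sum_mono) (auto simp: abs_mult intro: mult_le_one order_trans[OF mult_left_le_one_le])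
    also have "\<dots> \<le> n * c" using increment_bound_nonneg by (auto intro!: mult_right_mono)
    finally show ?thesis .
  qed
  have int: "integrable M f" if "f \<in> borel_measurable M" "\<And>\<omega>. \<omega> \<in> space M \<Longrightarrow> \<bar>f \<omega>\<bar> \<le> b" for f :: "'a \<Rightarrow> real" and b
    using that by (intro integrable_const_bound[where B=b]) auto
  have D2: "integrable M (\<lambda>\<omega>. (D i \<omega>)\<^sup>2)" for i
    by (rule int[of _ "c\<^sup>2"]) (use D_bound increment_bound_nonneg in \<open>auto intro!: abs_le_square_iff[THEN iffD1]\<close>)
  have T2: "integrable M (\<lambda>\<omega>. (T i \<omega>)\<^sup>2)" for i
    by (rule int[of _ "(i * c)\<^sup>2"]) (use T_bound increment_bound_nonneg in \<open>auto intro!: abs_le_square_iff[THEN iffD1] simp: abs_mult\<close>)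
  have TH: "\<bar>2 * T n \<omega> * H n \<omega>\<bar> \<le> 2 * (n * c)" if "\<omega> \<in> space M" for n \<omega>
    using mult_mono[OF T_bound[OF that, of n] H01(2)[of n \<omega>]] H01(1)[of n \<omega>] increment_bound_nonneg by (simp add: abs_mult)
  have second: "expectation (\<lambda>\<omega>. (T n \<omega>)\<^sup>2) \<le> (\<Sum>i=m..<n. expectation (\<lambda>\<omega>. (D i \<omega>)\<^sup>2))" for n
  proof (induction n)
    case 0
    then show ?case by (simp add: T_def)
  next
    case (Suc n)
    show ?case
    proof (cases "m \<le> n")
      case True
      have iTHD: "integrable M (\<lambda>\<omega>. (2 * T n \<omega> * H n \<omega>) * D n \<omega>)"
        using mult_mono[OF TH D_bound] by (intro int[of _ "2 * (n * c) * c"]) (auto simp: abs_mult increment_bound_nonneg)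
      have iHD: "integrable M (\<lambda>\<omega>. H n \<omega> * (D n \<omega>)\<^sup>2)"
        by (rule Bochner_Integration.integrable_bound[OF D2[of n]]) (use H01 in \<open>auto simp: mult_left_le_one_le\<close>)
      have "expectation (\<lambda>\<omega>. (T (Suc n) \<omega>)\<^sup>2)
          = expectation (\<lambda>\<omega>. (T n \<omega>)\<^sup>2 + (2 * T n \<omega> * H n \<omega>) * D n \<omega> + H n \<omega> * (D n \<omega>)\<^sup>2)"
      proof (rule Bochner_Integration.integral_cong)
        fix \<omega>
        have "T (Suc n) \<omega> = T n \<omega> + H n \<omega> * D n \<omega>" using True by (simp add: T_def)
        then have "(T (Suc n) \<omega>)\<^sup>2 = (T n \<omega>)\<^sup>2 + 2 * T n \<omega> * H n \<omega> * D n \<omega> + (H n \<omega> * H n \<omega>) * (D n \<omega>)\<^sup>2"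
          by (simp add: power2_eq_square algebra_simps)
        then show "(T (Suc n) \<omega>)\<^sup>2 = (T n \<omega>)\<^sup>2 + 2 * T n \<omega> * H n \<omega> * D n \<omega> + H n \<omega> * (D n \<omega>)\<^sup>2"
          by (simp only: H01)
      qed simp
      also have "\<dots> = expectation (\<lambda>\<omega>. (T n \<omega>)\<^sup>2) + expectation (\<lambda>\<omega>. (2 * T n \<omega> * H n \<omega>) * D n \<omega>)
          + expectation (\<lambda>\<omega>. H n \<omega> * (D n \<omega>)\<^sup>2)"
        using T2[of n] iTHD iHD by simp
      \<comment> \<open>The cross term vanishes because its first factor is bounded and
        \<open>F n\<close>-measurable; stopping can only decrease the remaining square.\<close>
      also have "expectation (\<lambda>\<omega>. (2 * T n \<omega> * H n \<omega>) * D n \<omega>) = 0"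
        using TH by (intro D_orth borel_measurable_times borel_measurable_const T_F H_F)
      also have "expectation (\<lambda>\<omega>. H n \<omega> * (D n \<omega>)\<^sup>2) \<le> expectation (\<lambda>\<omega>. (D n \<omega>)\<^sup>2)"
        by (rule integral_mono[OF iHD D2]) (use H01 in \<open>auto simp: mult_left_le_one_le\<close>)
      finally show ?thesis using Suc True by simp
    qed (simp add: T_def)
  qed
  have "{\<omega> \<in> space M. \<exists>j\<in>{m..n}. \<epsilon> \<le> \<bar>\<Sum>i=m..<j. D i \<omega>\<bar>} \<subseteq> {\<omega> \<in> space M. \<bar>T n \<omega>\<bar> \<ge> \<epsilon>}"
  proof safe
    fix \<omega> j assume "j \<in> {m..n}" "\<epsilon> \<le> \<bar>\<Sum>i=m..<j. D i \<omega>\<bar>"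
    \<comment> \<open>The first exit index. \<open>H\<close> equals 1 strictly before it and 0 from
      it on, so \<open>T n\<close> is frozen at the partial sum that left the interval.\<close>
    define j0 where "j0 = (LEAST j. m \<le> j \<and> \<epsilon> \<le> \<bar>\<Sum>i=m..<j. D i \<omega>\<bar>)"
    have j0: "m \<le> j0" "\<epsilon> \<le> \<bar>\<Sum>i=m..<j0. D i \<omega>\<bar>" "j0 \<le> n"
      using LeastI[of "\<lambda>j. m \<le> j \<and> \<epsilon> \<le> \<bar>\<Sum>i=m..<j. D i \<omega>\<bar>" j]
        Least_le[of "\<lambda>j. m \<le> j \<and> \<epsilon> \<le> \<bar>\<Sum>i=m..<j. D i \<omega>\<bar>" j]
        \<open>j \<in> {m..n}\<close> \<open>\<epsilon> \<le> \<bar>\<Sum>i=m..<j. D i \<omega>\<bar>\<close>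
      by (auto simp: j0_def)
    have lt: "\<bar>\<Sum>i=m..<j. D i \<omega>\<bar> < \<epsilon>" if "m \<le> j" "j < j0" for j
      using not_less_Least[of j "\<lambda>j. m \<le> j \<and> \<epsilon> \<le> \<bar>\<Sum>i=m..<j. D i \<omega>\<bar>"] that by (auto simp: j0_def)
    have "T n \<omega> = (\<Sum>i=m..<j0. H i \<omega> * D i \<omega>) + (\<Sum>i=j0..<n. H i \<omega> * D i \<omega>)"
      unfolding T_def using j0 by (simp add: sum.atLeastLessThan_concat)
    also have "(\<Sum>i=j0..<n. H i \<omega> * D i \<omega>) = 0"
      using j0 by (intro sum.neutral) (force simp: H_def)
    also have "(\<Sum>i=m..<j0. H i \<omega> * D i \<omega>) = (\<Sum>i=m..<j0. D i \<omega>)"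
      using lt by (intro sum.cong) (auto simp: H_def)
    finally show "\<epsilon> \<le> \<bar>T n \<omega>\<bar>" using j0 by simp
  qed
  then have "prob {\<omega> \<in> space M. \<exists>j\<in>{m..n}. \<epsilon> \<le> \<bar>\<Sum>i=m..<j. D i \<omega>\<bar>} \<le> prob {\<omega> \<in> space M. \<bar>T n \<omega>\<bar> \<ge> \<epsilon>}"
    by (intro finite_measure_mono) auto
  also have "\<dots> \<le> expectation (\<lambda>\<omega>. (T n \<omega>)\<^sup>2) / \<epsilon>\<^sup>2"
    using T2 \<open>\<epsilon> > 0\<close> by (intro second_moment_method) auto
  also have "\<dots> \<le> (\<Sum>i=m..<n. expectation (\<lambda>\<omega>. (D i \<omega>)\<^sup>2)) / \<epsilon>\<^sup>2"
    using second by (intro divide_right_mono) auto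
  finally show ?thesis .
qed

text \<open>The events for finite horizons increase to this one, and their bounds are all dominated
  by the same tail of the series.\<close>

lemma maximal_inequality:
  fixes \<epsilon> :: real
  assumes "\<epsilon> > 0" and summ: "summable (\<lambda>n. expectation (\<lambda>\<omega>. (D n \<omega>)\<^sup>2))"
  shows "prob {\<omega> \<in> space M. \<exists>j\<ge>m. \<epsilon> \<le> \<bar>\<Sum>i=m..<j. D i \<omega>\<bar>}
      \<le> (\<Sum>i. expectation (\<lambda>\<omega>. (D (i + m) \<omega>)\<^sup>2)) / \<epsilon>\<^sup>2"
proof -
  note [measurable] = increment_measurable
  let ?A = "\<lambda>n. {\<omega> \<in> space M. \<exists>j\<in>{m..n}. \<epsilon> \<le> \<bar>\<Sum>i=m..<j. D i \<omega>\<bar>}"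
  have "(\<lambda>n. prob (?A n)) \<longlonglongrightarrow> prob (\<Union>n. ?A n)"
    by (rule finite_Lim_measure_incseq) (auto simp: incseq_def)
  moreover have "(\<Union>n. ?A n) = {\<omega> \<in> space M. \<exists>j\<ge>m. \<epsilon> \<le> \<bar>\<Sum>i=m..<j. D i \<omega>\<bar>}"
    by auto (metis atLeastAtMost_iff order_refl)
  moreover have "prob (?A n) \<le> (\<Sum>i. expectation (\<lambda>\<omega>. (D (i + m) \<omega>)\<^sup>2)) / \<epsilon>\<^sup>2" for n
  proof -
    have "(\<Sum>i=m..<n. expectation (\<lambda>\<omega>. (D i \<omega>)\<^sup>2)) \<le> (\<Sum>i<n. expectation (\<lambda>\<omega>. (D (i + m) \<omega>)\<^sup>2))"
    proof (cases "m \<le> n")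
      case True
      then have "(\<Sum>i=m..<n. expectation (\<lambda>\<omega>. (D i \<omega>)\<^sup>2)) = (\<Sum>i<n-m. expectation (\<lambda>\<omega>. (D (i + m) \<omega>)\<^sup>2))"
        using sum.shift_bounds_nat_ivl[of "\<lambda>i. expectation (\<lambda>\<omega>. (D i \<omega>)\<^sup>2)" 0 m "n - m"]
        by (simp add: atLeast0LessThan)
      also have "\<dots> \<le> (\<Sum>i<n. expectation (\<lambda>\<omega>. (D (i + m) \<omega>)\<^sup>2))"
        by (intro sum_mono2) auto
      finally show ?thesis .
    qed (auto intro: sum_nonneg)
    also have "\<dots> \<le> (\<Sum>i. expectation (\<lambda>\<omega>. (D (i + m) \<omega>)\<^sup>2))"
      by (intro sum_le_suminf) (use summ in \<open>auto simp: summable_iff_shift[of "\<lambda>n. expectation (\<lambda>\<omega>. (D n \<omega>)\<^sup>2)"]\<close>)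
    finally show ?thesis
      using maximal_inequality_finite[OF \<open>\<epsilon> > 0\<close>, of m n] \<open>\<epsilon> > 0\<close>
      by (meson divide_right_mono order_trans zero_le_power2)
  qed
  ultimately show ?thesis by (intro LIMSEQ_le_const2) auto
qed

text \<open>If the partial sums are not Cauchy, then for some \<open>\<epsilon>\<close> the path
  lies in \<open>?A \<epsilon> m\<close> for every starting index \<open>m\<close>. The maximal
  inequality bounds the probability of this by every tail of a convergent series, hence by 0, and
  the countable family of radii \<open>inverse (Suc k)\<close> suffices.\<close>

lemma martingale_increments_convergent:
  assumes summ: "summable (\<lambda>n. expectation (\<lambda>\<omega>. (D n \<omega>)\<^sup>2))"
  shows "AE \<omega> in M. convergent (\<lambda>n. \<Sum>i<n. D i \<omega>)"
proof -
  note [measurable] = increment_measurable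
  let ?A = "\<lambda>\<epsilon> m. {\<omega> \<in> space M. \<exists>j\<ge>m. \<epsilon> \<le> \<bar>\<Sum>i=m..<j. D i \<omega>\<bar>}"
  have "AE \<omega> in M. \<exists>m. \<omega> \<notin> ?A \<epsilon> m" if "\<epsilon> > 0" for \<epsilon>
  proof (rule AE_I')
    have [measurable]: "?A \<epsilon> m \<in> sets M" for m by measurable
    have le: "prob (\<Inter>m. ?A \<epsilon> m) \<le> (\<Sum>i. expectation (\<lambda>\<omega>. (D (i + m) \<omega>)\<^sup>2)) / \<epsilon>\<^sup>2" for m
      using maximal_inequality[OF \<open>\<epsilon> > 0\<close> summ, of m]
      by (rule order_trans[rotated]) (auto intro!: finite_measure_mono)
    have "(\<lambda>m. (\<Sum>i. expectation (\<lambda>\<omega>. (D (i + m) \<omega>)\<^sup>2)) / \<epsilon>\<^sup>2) \<longlonglongrightarrow> 0"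
      using tendsto_divide[OF suminf_exist_split2[OF summ] tendsto_const[of "\<epsilon>\<^sup>2"]] \<open>\<epsilon> > 0\<close> by simp
    then have "prob (\<Inter>m. ?A \<epsilon> m) \<le> 0"
      using le by (intro LIMSEQ_le_const) auto
    then have "prob (\<Inter>m. ?A \<epsilon> m) = 0" by (simp add: measure_le_0_iff)
    then show "(\<Inter>m. ?A \<epsilon> m) \<in> null_sets M"
      by (intro null_setsI) (auto simp: emeasure_eq_measure)
  qed auto
  then have "AE \<omega> in M. \<forall>k. \<exists>m. \<omega> \<notin> ?A (inverse (real (Suc k))) m"
    by (subst AE_all_countable) auto
  then show ?thesis
    using AE_space
  proof eventually_elim
    case (elim \<omega>)
    show ?case
    proof (rule Cauchy_convergent, rule metric_CauchyI)
      fix e :: real assume "e > 0"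
      obtain k where k: "inverse (real (Suc k)) < e / 2" using reals_Archimedean[of "e / 2"] \<open>e > 0\<close> by auto
      obtain m where m: "\<And>j. j \<ge> m \<Longrightarrow> \<bar>\<Sum>i=m..<j. D i \<omega>\<bar> < e / 2"
        using elim k by (metis (mono_tags, lifting) mem_Collect_eq not_le_imp_less order_less_trans)
      have m': "\<bar>(\<Sum>i<j. D i \<omega>) - (\<Sum>i<m. D i \<omega>)\<bar> < e / 2" if "j \<ge> m" for j
        using m[OF that] that sum_diff_nat_ivl[of 0 m j "\<lambda>i. D i \<omega>"] by (simp add: atLeast0LessThan)
      show "\<exists>N. \<forall>i\<ge>N. \<forall>j\<ge>N. dist (\<Sum>i<i. D i \<omega>) (\<Sum>i<j. D i \<omega>) < e"
      proof (intro exI[of _ m] allI impI)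
        fix i j assume "i \<ge> m" "j \<ge> m"
        then show "dist (\<Sum>i<i. D i \<omega>) (\<Sum>i<j. D i \<omega>) < e"
          using m'[of i] m'[of j] unfolding dist_real_def by linarith
      qed
    qed
  qed
qed

end

end

section \<open>Robust dynamic programming\<close>

lemma abs_Max_image_diff_le:
  fixes f g :: "'b \<Rightarrow> real"
  assumes "finite S" "S \<noteq> {}" "\<And>s. s \<in> S \<Longrightarrow> \<bar>f s - g s\<bar> \<le> B"
  shows "\<bar>Max (f ` S) - Max (g ` S)\<bar> \<le> B"
proof -
  have "Max (f ` S) \<le> Max (g ` S) + B" if "\<And>s. s \<in> S \<Longrightarrow> \<bar>f s - g s\<bar> \<le> B" for f g
  proof (rule Max.boundedI)
    fix v assume "v \<in> f ` S"
    then obtain s where s: "s \<in> S" "v = f s" by auto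
    have "g s \<le> Max (g ` S)" using s assms by (intro Max_ge) auto
    with that[OF s(1)] s show "v \<le> Max (g ` S) + B" by linarith
  qed (use assms in auto)
  from this[of f g] this[of g f] assms(3) show ?thesis by (force simp: abs_minus_commute abs_le_iff)
qed

lemma abs_Min_image_diff_le:
  fixes f g :: "'b \<Rightarrow> real"
  assumes "finite S" "S \<noteq> {}" "\<And>s. s \<in> S \<Longrightarrow> \<bar>f s - g s\<bar> \<le> B"
  shows "\<bar>Min (f ` S) - Min (g ` S)\<bar> \<le> B"
proof -
  have "Min (f ` S) - B \<le> Min (g ` S)" if "\<And>s. s \<in> S \<Longrightarrow> \<bar>f s - g s\<bar> \<le> B" for f g
  proof (rule Min.boundedI)
    fix v assume "v \<in> g ` S"
    then obtain s where s: "s \<in> S" "v = g s" by auto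
    have "Min (f ` S) \<le> f s" using s assms by (intro Min_le) auto
    with that[OF s(1)] s show "Min (f ` S) - B \<le> v" by linarith
  qed (use assms in auto)
  from this[of f g] this[of g f] assms(3) show ?thesis by (force simp: abs_minus_commute abs_le_iff)
qed

lemma (in finite_measure) integral_count_space_finite:
  fixes f :: "'a \<Rightarrow> real"
  assumes "sets M = sets (count_space S)" "finite S"
  shows "(\<integral>y. f y \<partial>M) = (\<Sum>y\<in>S. f y * measure M {y})"
proof -
  have sp: "space M = S" using sets_eq_imp_space_eq[OF assms(1)] by simp
  have "(\<integral>y. f y \<partial>M) = (\<integral>y. (\<Sum>z\<in>S. f z * indicator {z} y) \<partial>M)"
    using assms(2) by (intro Bochner_Integration.integral_cong refl) (auto simp: sp indicator_def if_distrib cong: if_cong)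
  also have "\<dots> = (\<Sum>z\<in>S. f z * measure M {z})"
    using assms sp by (subst Bochner_Integration.integral_sum) (auto simp: less_top[symmetric])
  finally show ?thesis .
qed

locale robust_mdp =
  fixes X :: "'x set" and A :: "'a set" and r :: "'x \<Rightarrow> 'a \<Rightarrow> 'x \<Rightarrow> real"
    and \<alpha> :: real and N :: nat and p :: "nat \<Rightarrow> 'x \<Rightarrow> 'a \<Rightarrow> 'x measure"
  assumes finite_X: "finite X" and X_ne: "X \<noteq> {}" and finite_A: "finite A" and A_ne: "A \<noteq> {}"
    and N: "N \<ge> 1"
    and p: "\<And>k x b. k \<in> {1..N} \<Longrightarrow> x \<in> X \<Longrightarrow> b \<in> A \<Longrightarrow> p k x b \<in> space (prob_algebra (count_space X))"
    and \<alpha>: "0 < \<alpha>" "\<alpha> < 1"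
begin

text \<open>The robust Bellman operator. It is written through \<open>selection_cost\<close> with
  the true weights so that it differs from the objective minimized by the algorithm only in the
  weights.\<close>

definition bellman :: "('x \<Rightarrow> 'a \<Rightarrow> real) \<Rightarrow> 'x \<Rightarrow> 'a \<Rightarrow> real" where
  "bellman q x b = Min ((\<lambda>k. selection_cost X A r \<alpha> q x b (\<lambda>y. measure (p k x b) {y})) ` {1..N})"

definition r_max :: real where
  "r_max = Max ((\<lambda>(x, b, y). \<bar>r x b y\<bar>) ` (X \<times> A \<times> X))"

lemma abs_le_sum_sum:
  fixes f :: "'x \<Rightarrow> 'a \<Rightarrow> real"
  assumes "x \<in> X" "b \<in> A"
  shows "\<bar>f x b\<bar> \<le> (\<Sum>x\<in>X. \<Sum>b\<in>A. \<bar>f x b\<bar>)"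
proof -
  have "\<bar>f x b\<bar> \<le> (\<Sum>b\<in>A. \<bar>f x b\<bar>)"
    using assms finite_A by (intro member_le_sum) auto
  also have "\<dots> \<le> (\<Sum>x\<in>X. \<Sum>b\<in>A. \<bar>f x b\<bar>)"
    using assms finite_X by (intro member_le_sum[where f="\<lambda>x. \<Sum>b\<in>A. \<bar>f x b\<bar>"]) (auto intro: sum_nonneg)
  finally show ?thesis .
qed

lemma r_le: "x \<in> X \<Longrightarrow> b \<in> A \<Longrightarrow> y \<in> X \<Longrightarrow> \<bar>r x b y\<bar> \<le> r_max"
  unfolding r_max_def using finite_X finite_A by (intro Max_ge) force+

lemma r_max_nonneg: "0 \<le> r_max"
  using r_le X_ne A_ne abs_ge_zero order_trans by (metis all_not_in_conv)

lemma prob_kernel: "k \<in> {1..N} \<Longrightarrow> x \<in> X \<Longrightarrow> b \<in> A \<Longrightarrow> prob_space (p k x b)"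
  and sets_kernel: "k \<in> {1..N} \<Longrightarrow> x \<in> X \<Longrightarrow> b \<in> A \<Longrightarrow> sets (p k x b) = sets (count_space X)"
  using p by (auto simp: space_prob_algebra)

lemma integral_kernel:
  assumes "k \<in> {1..N}" "x \<in> X" "b \<in> A"
  shows "(\<integral>y. f y \<partial>p k x b) = (\<Sum>y\<in>X. f y * measure (p k x b) {y})"
proof -
  interpret prob_space "p k x b" using assms by (rule prob_kernel)
  show ?thesis using integral_count_space_finite[OF sets_kernel[OF assms] finite_X, of f] .
qed

lemma sum_kernel:
  assumes "k \<in> {1..N}" "x \<in> X" "b \<in> A"
  shows "(\<Sum>y\<in>X. measure (p k x b) {y}) = 1"
proof -
  interpret prob_space "p k x b" using assms by (rule prob_kernel)
  show ?thesis using integral_kernel[OF assms, of "\<lambda>_. 1"] prob_space by simp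
qed

lemma selection_cost_diff_le:
  assumes q: "\<And>y c. y \<in> X \<Longrightarrow> c \<in> A \<Longrightarrow> \<bar>q y c - q' y c\<bar> \<le> B"
    and k: "k \<in> {1..N}" "x \<in> X" "b \<in> A"
  shows "\<bar>selection_cost X A r \<alpha> q x b (\<lambda>y. measure (p k x b) {y})
      - selection_cost X A r \<alpha> q' x b (\<lambda>y. measure (p k x b) {y})\<bar> \<le> \<alpha> * B"
proof -
  have "\<bar>selection_cost X A r \<alpha> q x b (\<lambda>y. measure (p k x b) {y})
      - selection_cost X A r \<alpha> q' x b (\<lambda>y. measure (p k x b) {y})\<bar>
     = \<bar>\<Sum>y\<in>X. \<alpha> * (Max ((\<lambda>c. q y c) ` A) - Max ((\<lambda>c. q' y c) ` A)) * measure (p k x b) {y}\<bar>"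
    unfolding selection_cost_def by (simp add: sum_subtractf[symmetric] algebra_simps)
  also have "\<dots> \<le> (\<Sum>y\<in>X. \<alpha> * B * measure (p k x b) {y})"
  proof (rule order_trans[OF sum_abs sum_mono])
    fix y assume "y \<in> X"
    then have "\<bar>Max ((\<lambda>c. q y c) ` A) - Max ((\<lambda>c. q' y c) ` A)\<bar> \<le> B"
      using q finite_A A_ne by (intro abs_Max_image_diff_le) auto
    then show "\<bar>\<alpha> * (Max ((\<lambda>c. q y c) ` A) - Max ((\<lambda>c. q' y c) ` A)) * measure (p k x b) {y}\<bar>
        \<le> \<alpha> * B * measure (p k x b) {y}"
      using \<alpha> by (auto simp: abs_mult intro!: mult_right_mono)
  qed
  also have "\<dots> = \<alpha> * B" using sum_kernel[OF k] by (simp flip: sum_distrib_left)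
  finally show ?thesis .
qed

lemma bellman_contraction:
  assumes q: "\<And>y c. y \<in> X \<Longrightarrow> c \<in> A \<Longrightarrow> \<bar>q y c - q' y c\<bar> \<le> B" and x: "x \<in> X" "b \<in> A"
  shows "\<bar>bellman q x b - bellman q' x b\<bar> \<le> \<alpha> * B"
  unfolding bellman_def using selection_cost_diff_le[OF q _ x] N
  by (intro abs_Min_image_diff_le) auto

text \<open>Banach's iteration, started at 0. The contraction controls only the entries in
  \<open>X\<close> and \<open>A\<close>, which gives a seminorm on total functions, so convergence
  is shown entry by entry from the geometric decay of successive differences.\<close>

lemma bellman_fixed_point: "\<exists>q. \<forall>x\<in>X. \<forall>b\<in>A. bellman q x b = q x b"
proof -
  define v where "v = rec_nat (\<lambda>_ _. 0) (\<lambda>_ q. bellman q)"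
  have v_Suc: "v (Suc n) = bellman (v n)" for n by (simp add: v_def)
  define C where "C = (\<Sum>x\<in>X. \<Sum>b\<in>A. \<bar>v 1 x b - v 0 x b\<bar>)"
  have C: "\<bar>v 1 x b - v 0 x b\<bar> \<le> C" if "x \<in> X" "b \<in> A" for x b
    unfolding C_def using that by (rule abs_le_sum_sum[where f="\<lambda>x b. v 1 x b - v 0 x b"])
  have step: "\<bar>v (Suc n) x b - v n x b\<bar> \<le> \<alpha> ^ n * C" if "x \<in> X" "b \<in> A" for n x b
    using that
  proof (induction n arbitrary: x b)
    case (Suc n)
    then show ?case
      using bellman_contraction[of "v (Suc n)" "v n" "\<alpha> ^ n * C" x b] by (simp add: v_Suc mult.assoc)
  qed (use C in simp)
  have "\<exists>l. (\<lambda>n. v n x b) \<longlonglongrightarrow> l" if "x \<in> X" "b \<in> A" for x b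
  proof -
    have "summable (\<lambda>n. v (Suc n) x b - v n x b)"
      by (rule summable_comparison_test'[of "\<lambda>n. \<alpha> ^ n * C" 0])
        (use step[OF that] \<alpha> in \<open>auto intro!: summable_mult2 summable_geometric\<close>)
    then have "convergent (\<lambda>n. \<Sum>i<n. v (Suc i) x b - v i x b)" by (simp add: summable_iff_convergent)
    then obtain l where "(\<lambda>n. v n x b - v 0 x b) \<longlonglongrightarrow> l"
      unfolding sum_lessThan_telescope[of "\<lambda>n. v n x b"] by (auto simp: convergent_def)
    from tendsto_add[OF this tendsto_const[of "v 0 x b"]] show ?thesis by auto
  qed
  then obtain q where q: "\<And>x b. x \<in> X \<Longrightarrow> b \<in> A \<Longrightarrow> (\<lambda>n. v n x b) \<longlonglongrightarrow> q x b" by metis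
  have "bellman q x b = q x b" if x: "x \<in> X" "b \<in> A" for x b
  proof -
    \<comment> \<open>A finite sum dominating the sup distance: it tends to 0 because its terms do,
      and the contraction carries this over to \<open>bellman\<close>.\<close>
    define e where "e n = (\<Sum>x\<in>X. \<Sum>b\<in>A. \<bar>v n x b - q x b\<bar>)" for n
    have e: "\<bar>v n x b - q x b\<bar> \<le> e n" if "x \<in> X" "b \<in> A" for n x b
      unfolding e_def using that by (rule abs_le_sum_sum[where f="\<lambda>x b. v n x b - q x b"])
    have "e \<longlonglongrightarrow> 0" unfolding e_def
      by (intro tendsto_null_sum tendsto_rabs_zero) (use q in \<open>simp add: LIM_zero\<close>)
    then have "(\<lambda>n. \<alpha> * e n) \<longlonglongrightarrow> 0" by (rule tendsto_mult_right_zero)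
    then have "(\<lambda>n. v (Suc n) x b - bellman q x b) \<longlonglongrightarrow> 0"
      by (rule Lim_null_comparison[rotated])
        (auto simp: v_Suc intro!: always_eventually bellman_contraction e x)
    then have "(\<lambda>n. v (Suc n) x b) \<longlonglongrightarrow> bellman q x b" by (simp add: LIM_zero_iff)
    moreover have "(\<lambda>n. v (Suc n) x b) \<longlonglongrightarrow> q x b" using q[OF x] by (rule LIMSEQ_Suc)
    ultimately show ?thesis by (rule LIMSEQ_unique)
  qed
  then show ?thesis by blast
qed

section \<open>Path laws of time-inhomogeneous Markov chains and their discounted returns\<close>

context
  fixes x :: 'x and K :: "nat \<Rightarrow> 'x \<Rightarrow> 'x measure"
  assumes x: "x \<in> X" and K: "\<And>t y. y \<in> X \<Longrightarrow> K t y \<in> space (prob_algebra (count_space X))"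
begin

abbreviation "L \<equiv> path_law X x K"

lemma sets_path_law: "sets L = sets (PiM UNIV (\<lambda>_. count_space X))"
  and space_path_law: "space L = UNIV \<rightarrow>\<^sub>E X"
proof -
  interpret IT: Ionescu_Tulcea "path_kernel X x K" "\<lambda>_. count_space X"
    using x K by (rule Ionescu_Tulcea_path_kernel)
  show "sets L = sets (PiM UNIV (\<lambda>_. count_space X))" by (simp add: path_law_def)
  show "space L = UNIV \<rightarrow>\<^sub>E X" by (simp add: path_law_def space_PiM)
qed

lemma path_component[measurable]: "(\<lambda>\<omega>. \<omega> t) \<in> measurable L (count_space X)"
  using measurable_component_singleton[of t UNIV "\<lambda>_. count_space X"]
  by (simp add: measurable_cong_sets[OF sets_path_law refl])

text \<open>The total mass is read off the marginal on the empty set of coordinates, which belongs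
  to the projective family and hence has mass 1.\<close>

lemma prob_path_law: "prob_space L"
proof -
  interpret IT: Ionescu_Tulcea "path_kernel X x K" "\<lambda>_. count_space X"
    using x K by (rule Ionescu_Tulcea_path_kernel)
  show ?thesis
  proof (rule prob_space_distrD)
    show "(\<lambda>\<omega>. restrict \<omega> {}) \<in> measurable L (PiM {} (\<lambda>_. count_space X))"
      unfolding measurable_cong_sets[OF sets_path_law refl] by (rule measurable_restrict_subset) simp
    show "prob_space (distr L (PiM {} (\<lambda>_. count_space X)) (\<lambda>\<omega>. restrict \<omega> {}))"
      unfolding path_law_def IT.distr_lim[OF finite.emptyI] by (rule IT.PF.prob_space_P) simp_all
  qed
qed


lemma measure_cylinder:
  assumes w: "\<And>i. w i \<in> X"
  shows "measure L {\<omega> \<in> space L. \<forall>i\<le>n. \<omega> i = w i} = of_bool (w 0 = x) * (\<Prod>i<n. measure (K i (w i)) {w (Suc i)})"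
proof -
  interpret prob_space L by (rule prob_path_law)
  have "emeasure (K i (w i)) {w (Suc i)} = ennreal (measure (K i (w i)) {w (Suc i)})" for i
  proof -
    interpret K: prob_space "K i (w i)" using K[of "w i" i] w[of i] by (simp add: space_prob_algebra)
    show ?thesis by (rule K.emeasure_eq_measure)
  qed
  then have "emeasure L {\<omega> \<in> space L. \<forall>i\<le>n. \<omega> i = w i}
      = ennreal (of_bool (w 0 = x) * (\<Prod>i<n. measure (K i (w i)) {w (Suc i)}))"
    using emeasure_path_law[where K=K and X=X and x=x and w=w and n=n] x K w
    by (simp add: prod_ennreal of_bool_def)
  then show ?thesis by (simp add: measure_def prod_nonneg)
qed

lemma sets_path_law_eq: "{\<omega> \<in> space L. \<omega> t = y} \<in> sets L"
proof -
  have "{\<omega> \<in> space L. \<omega> t = y} = (\<lambda>\<omega>. \<omega> t) -` ({y} \<inter> X) \<inter> space L" by (auto simp: space_path_law)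
  also have "\<dots> \<in> sets L" by (rule measurable_sets[OF path_component]) simp
  finally show ?thesis .
qed

text \<open>The one-step Markov property. Both events are disjoint unions of cylinders over all
  prefixes of length \<open>t\<close>, and by the product formula lengthening a cylinder by
  \<open>z\<close> multiplies its measure by the same transition weight for every prefix.\<close>

lemma measure_step:
  assumes "y \<in> X" "z \<in> X"
  shows "measure L {\<omega> \<in> space L. \<omega> t = y \<and> \<omega> (Suc t) = z}
      = measure L {\<omega> \<in> space L. \<omega> t = y} * measure (K t y) {z}"
proof -
  interpret prob_space L by (rule prob_path_law)
  define W where "W = PiE {..<t} (\<lambda>_. X)"
  \<comment> \<open>The prefix is continued to an infinite sequence, constantly \<open>z\<close>
    after time \<open>t\<close>, because the cylinder formula asks for all coordinates to lie in
    \<open>X\<close>.\<close>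
  define ext where "ext w = (\<lambda>i. if i < t then w i else if i = t then y else z)" for w
  have finW: "finite W" unfolding W_def by (intro finite_PiE finite_X) auto
  have ext: "ext w i \<in> X" if "w \<in> W" for w i
    using that assms by (auto simp: ext_def W_def)
  let ?A = "\<lambda>n w. {\<omega> \<in> space L. \<forall>i\<le>n. \<omega> i = ext w i}"
  have [measurable]: "?A n w \<in> sets L" for n w
    using sets.sets_Collect_finite_All[of "{..n}" L "\<lambda>i \<omega>. \<omega> i = ext w i"] sets_path_law_eq by simp
  have disj: "disjoint_family_on (?A n) W" if "t \<le> n" for n
    unfolding disjoint_family_on_def
  proof (intro ballI impI, rule ccontr)
    fix w w' assume w: "w \<in> W" "w' \<in> W" "w \<noteq> w'" and "?A n w \<inter> ?A n w' \<noteq> {}"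
    then obtain \<omega> where "\<forall>i\<le>n. \<omega> i = ext w i" "\<forall>i\<le>n. \<omega> i = ext w' i" by auto
    then have "w i = w' i" if "i < t" for i
      using that \<open>t \<le> n\<close> by (metis ext_def less_imp_le order_trans)
    then have "w = w'" using w unfolding W_def by (intro PiE_ext) auto
    with w show False by simp
  qed
  have pref: "restrict \<omega> {..<t} \<in> W" if "\<omega> \<in> space L" for \<omega>
    using that by (auto simp: W_def space_path_law)
  have 1: "{\<omega> \<in> space L. \<omega> t = y} = (\<Union>w\<in>W. ?A t w)"
  proof (intro set_eqI iffI)
    fix \<omega> assume "\<omega> \<in> {\<omega> \<in> space L. \<omega> t = y}"
    then show "\<omega> \<in> (\<Union>w\<in>W. ?A t w)"
      using pref[of \<omega>] by (intro UN_I[of "restrict \<omega> {..<t}"]) (auto simp: ext_def)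
  qed (auto simp: ext_def)
  have 2: "{\<omega> \<in> space L. \<omega> t = y \<and> \<omega> (Suc t) = z} = (\<Union>w\<in>W. ?A (Suc t) w)"
  proof (intro set_eqI iffI)
    fix \<omega> assume "\<omega> \<in> {\<omega> \<in> space L. \<omega> t = y \<and> \<omega> (Suc t) = z}"
    then show "\<omega> \<in> (\<Union>w\<in>W. ?A (Suc t) w)"
      using pref[of \<omega>] by (intro UN_I[of "restrict \<omega> {..<t}"]) (auto simp: ext_def le_Suc_eq)
  qed (auto simp: ext_def)
  have "measure L {\<omega> \<in> space L. \<omega> t = y \<and> \<omega> (Suc t) = z} = (\<Sum>w\<in>W. measure L (?A (Suc t) w))"
    unfolding 2 using disj[of "Suc t"] by (intro finite_measure_finite_Union finW) auto
  also have "\<dots> = (\<Sum>w\<in>W. measure L (?A t w) * measure (K t y) {z})"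
    using ext by (intro sum.cong refl) (simp only: measure_cylinder, simp add: ext_def)
  also have "\<dots> = measure L {\<omega> \<in> space L. \<omega> t = y} * measure (K t y) {z}"
    unfolding 1 using disj[of t]
    by (subst finite_measure_finite_Union[OF finW]) (auto simp: sum_distrib_right)
  finally show ?thesis .
qed

text \<open>A function of two successive states is a finite combination of indicators of the events
  in \<open>measure_step\<close>, so any \<open>h\<close> is integrable and its expectation reduces
  to transition weights.\<close>

lemma path_integral_step:
  fixes h :: "'x \<Rightarrow> 'x \<Rightarrow> real"
  shows "integrable L (\<lambda>\<omega>. h (\<omega> t) (\<omega> (Suc t)))"
    and "(\<integral>\<omega>. h (\<omega> t) (\<omega> (Suc t)) \<partial>L)
      = (\<Sum>y\<in>X. measure L {\<omega> \<in> space L. \<omega> t = y} * (\<Sum>z\<in>X. h y z * measure (K t y) {z}))"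
proof -
  interpret prob_space L by (rule prob_path_law)
  let ?B = "\<lambda>y z. {\<omega> \<in> space L. \<omega> t = y \<and> \<omega> (Suc t) = z}"
  have B: "?B y z \<in> sets L" for y z
    using sets.Int[OF sets_path_law_eq[of t y] sets_path_law_eq[of "Suc t" z]]
    by (rule back_subst[of "\<lambda>S. S \<in> sets L"]) auto
  have eq: "h (\<omega> t) (\<omega> (Suc t)) = (\<Sum>y\<in>X. \<Sum>z\<in>X. h y z * indicator (?B y z) \<omega>)" if "\<omega> \<in> space L" for \<omega>
  proof -
    have "(\<Sum>y\<in>X. \<Sum>z\<in>X. h y z * indicator (?B y z) \<omega>)
        = (\<Sum>y\<in>X. \<Sum>z\<in>X. if z = \<omega> (Suc t) then if y = \<omega> t then h y z else 0 else 0)"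
      using that by (intro sum.cong) (auto simp: indicator_def)
    also have "\<dots> = h (\<omega> t) (\<omega> (Suc t))"
      using that finite_X by (auto simp: space_path_law PiE_iff)
    finally show ?thesis ..
  qed
  have int: "integrable L (\<lambda>\<omega>. h y z * indicator (?B y z) \<omega>)" for y z
    using B by (auto simp: less_top[symmetric])
  then show "integrable L (\<lambda>\<omega>. h (\<omega> t) (\<omega> (Suc t)))"
    by (subst Bochner_Integration.integrable_cong[OF refl eq]) auto
  have "(\<integral>\<omega>. h (\<omega> t) (\<omega> (Suc t)) \<partial>L) = (\<integral>\<omega>. (\<Sum>y\<in>X. \<Sum>z\<in>X. h y z * indicator (?B y z) \<omega>) \<partial>L)"
    by (rule Bochner_Integration.integral_cong[OF refl eq])
  also have "\<dots> = (\<Sum>y\<in>X. \<Sum>z\<in>X. h y z * measure L (?B y z))"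
    using int B by (subst Bochner_Integration.integral_sum, force)+ simp
  also have "\<dots> = (\<Sum>y\<in>X. measure L {\<omega> \<in> space L. \<omega> t = y} * (\<Sum>z\<in>X. h y z * measure (K t y) {z}))"
    by (intro sum.cong refl) (simp add: measure_step sum_distrib_left sum_distrib_right mult_ac)
  finally show "(\<integral>\<omega>. h (\<omega> t) (\<omega> (Suc t)) \<partial>L)
      = (\<Sum>y\<in>X. measure L {\<omega> \<in> space L. \<omega> t = y} * (\<Sum>z\<in>X. h y z * measure (K t y) {z}))" .
qed

lemma AE_path_start: "AE \<omega> in L. \<omega> 0 = x"
proof -
  interpret prob_space L by (rule prob_path_law)
  have "measure L {\<omega> \<in> space L. \<omega> 0 = x} = 1"
    using measure_cylinder[of "\<lambda>_. x" 0] x by simp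
  then show ?thesis using prob_Collect_eq_1[OF sets_path_law_eq] by simp
qed

text \<open>A telescoping identity for an arbitrary \<open>u\<close>. With E and U the expected
  reward and the expected value of \<open>u\<close> at time t, the t-th term is \<alpha>^t (E t +
  \<alpha> U (t + 1) - U t). The U parts collapse to - U 0 = - \<open>u x\<close>, since \<alpha>^t
  U t tends to 0. Hence the sign of the one-step defects of \<open>u\<close> decides on which side
  of \<open>u x\<close> the return lies.\<close>

lemma discounted_return_defect:
  fixes u :: "'x \<Rightarrow> real"
  assumes a: "a \<in> policies X A"
  shows "(\<lambda>t. \<alpha> ^ t * (\<Sum>y\<in>X. measure L {\<omega> \<in> space L. \<omega> t = y} *
            ((\<Sum>z\<in>X. (r y (a t y) z + \<alpha> * u z) * measure (K t y) {z}) - u y)))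
      sums ((\<integral>\<omega>. (\<Sum>t. \<alpha> ^ t * r (\<omega> t) (a t (\<omega> t)) (\<omega> (Suc t))) \<partial>L) - u x)"
proof -
  interpret prob_space L by (rule prob_path_law)
  have aA: "a t y \<in> A" if "y \<in> X" for t y using a that by (auto simp: policies_def)
  let ?R = "\<lambda>t \<omega>. r (\<omega> t) (a t (\<omega> t)) (\<omega> (Suc t))"
  define E where "E t = (\<integral>\<omega>. ?R t \<omega> \<partial>L)" for t
  define U where "U t = (\<integral>\<omega>. u (\<omega> t) \<partial>L)" for t
  have sumK: "(\<Sum>z\<in>X. measure (K t y) {z}) = 1" if "y \<in> X" for t y
  proof -
    interpret K: prob_space "K t y" using K[OF that] by (simp add: space_prob_algebra)
    show ?thesis
      using K.integral_count_space_finite[of X "\<lambda>_. 1"] K[OF that, of t] finite_X K.prob_space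
      by (simp add: space_prob_algebra)
  qed
  have Rint: "integrable L (?R t)" for t
    by (rule path_integral_step(1)[where h="\<lambda>y z. r y (a t y) z"])
  have uint: "integrable L (\<lambda>\<omega>. u (\<omega> t))" for t
    by (rule path_integral_step(1)[where h="\<lambda>y z. u y"])
  have uint': "integrable L (\<lambda>\<omega>. u (\<omega> (Suc t)))" for t
    by (rule uint)
  have Rb: "\<bar>?R t \<omega>\<bar> \<le> r_max" if "\<omega> \<in> space L" for t \<omega>
    using that by (intro r_le aA) (auto simp: space_path_law)
  have Eb: "\<bar>E t\<bar> \<le> r_max" for t
  proof -
    have "\<bar>E t\<bar> \<le> (\<integral>\<omega>. \<bar>?R t \<omega>\<bar> \<partial>L)" unfolding E_def by (rule integral_abs_bound)
    also have "\<dots> \<le> (\<integral>\<omega>. r_max \<partial>L)" using Rint Rb by (intro integral_mono) auto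
    finally show ?thesis by (simp add: prob_space)
  qed
  have sumE: "summable (\<lambda>t. \<alpha> ^ t * E t)"
    by (rule summable_comparison_test'[of "\<lambda>t. \<alpha> ^ t * r_max" 0])
      (use Eb \<alpha> in \<open>auto simp: abs_mult intro!: summable_mult2 summable_geometric mult_left_mono\<close>)
  \<comment> \<open>Sum and integral may be exchanged because the terms are dominated by the
    geometric series with factor \<open>r_max\<close>.\<close>
  have J: "(\<integral>\<omega>. (\<Sum>t. \<alpha> ^ t * ?R t \<omega>) \<partial>L) = (\<Sum>t. \<alpha> ^ t * E t)"
  proof (subst integral_suminf)
    show "integrable L (\<lambda>\<omega>. \<alpha> ^ t * ?R t \<omega>)" for t using Rint by simp
    show "AE \<omega> in L. summable (\<lambda>t. norm (\<alpha> ^ t * ?R t \<omega>))"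
    proof (rule AE_I2, rule summable_comparison_test'[of "\<lambda>t. \<alpha> ^ t * r_max" 0])
      show "summable (\<lambda>t. \<alpha> ^ t * r_max)" using \<alpha> by (auto intro!: summable_mult2 summable_geometric)
      show "norm (norm (\<alpha> ^ t * ?R t \<omega>)) \<le> \<alpha> ^ t * r_max" if "\<omega> \<in> space L" for \<omega> t
        using Rb[OF that, of t] \<alpha> by (auto simp: abs_mult intro!: mult_left_mono)
    qed
    show "summable (\<lambda>t. \<integral>\<omega>. norm (\<alpha> ^ t * ?R t \<omega>) \<partial>L)"
    proof (rule summable_comparison_test'[of "\<lambda>t. \<alpha> ^ t * r_max" 0])
      show "summable (\<lambda>t. \<alpha> ^ t * r_max)" using \<alpha> by (auto intro!: summable_mult2 summable_geometric)
      fix t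
      have "(\<integral>\<omega>. norm (\<alpha> ^ t * ?R t \<omega>) \<partial>L) \<le> (\<integral>\<omega>. \<alpha> ^ t * r_max \<partial>L)"
        using Rint Rb \<alpha> by (intro integral_mono) (auto simp: abs_mult intro!: mult_left_mono)
      then show "norm (\<integral>\<omega>. norm (\<alpha> ^ t * ?R t \<omega>) \<partial>L) \<le> \<alpha> ^ t * r_max" by (simp add: prob_space)
    qed
    show "(\<Sum>t. \<integral>\<omega>. \<alpha> ^ t * ?R t \<omega> \<partial>L) = (\<Sum>t. \<alpha> ^ t * E t)" by (simp add: E_def)
  qed
  have defect: "(\<Sum>y\<in>X. measure L {\<omega> \<in> space L. \<omega> t = y} *
            ((\<Sum>z\<in>X. (r y (a t y) z + \<alpha> * u z) * measure (K t y) {z}) - u y))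
      = E t + \<alpha> * U (Suc t) - U t" (is "?l t = _") for t
  proof -
    have "E t + \<alpha> * U (Suc t) - U t
        = (\<integral>\<omega>. r (\<omega> t) (a t (\<omega> t)) (\<omega> (Suc t)) + \<alpha> * u (\<omega> (Suc t)) - u (\<omega> t) \<partial>L)"
      unfolding E_def U_def using Rint uint uint' by simp
    also have "\<dots> = (\<Sum>y\<in>X. measure L {\<omega> \<in> space L. \<omega> t = y} *
            (\<Sum>z\<in>X. (r y (a t y) z + \<alpha> * u z - u y) * measure (K t y) {z}))"
      by (rule path_integral_step(2)[where h="\<lambda>y z. r y (a t y) z + \<alpha> * u z - u y"])
    also have "\<dots> = ?l t"
      by (intro sum.cong refl arg_cong2[of _ _ _ _ "(*)"])
        (simp add: left_diff_distrib sum_subtractf sumK flip: sum_distrib_left)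
    finally show ?thesis ..
  qed
  have U0: "U 0 = u x"
  proof -
    have "U 0 = (\<integral>\<omega>. u x \<partial>L)" unfolding U_def
      using AE_path_start by (intro integral_cong_AE) (auto intro: borel_measurable_integrable uint elim: eventually_mono)
    then show ?thesis by (simp add: prob_space)
  qed
  have Ub: "\<bar>U t\<bar> \<le> (\<Sum>y\<in>X. \<bar>u y\<bar>)" for t
  proof -
    have "\<bar>U t\<bar> \<le> (\<integral>\<omega>. \<bar>u (\<omega> t)\<bar> \<partial>L)" unfolding U_def by (rule integral_abs_bound)
    also have "\<dots> \<le> (\<integral>\<omega>. (\<Sum>y\<in>X. \<bar>u y\<bar>) \<partial>L)"
      using uint finite_X by (intro integral_mono member_le_sum) (auto simp: space_path_law)
    finally show ?thesis by (simp add: prob_space)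
  qed
  have lim: "(\<lambda>t. \<alpha> ^ t * U t) \<longlonglongrightarrow> 0"
  proof (rule Lim_null_comparison)
    show "\<forall>\<^sub>F t in sequentially. norm (\<alpha> ^ t * U t) \<le> \<alpha> ^ t * (\<Sum>y\<in>X. \<bar>u y\<bar>)"
      using Ub \<alpha> by (auto simp: abs_mult intro!: always_eventually mult_left_mono)
    show "(\<lambda>t. \<alpha> ^ t * (\<Sum>y\<in>X. \<bar>u y\<bar>)) \<longlonglongrightarrow> 0"
      using \<alpha> by (auto intro!: tendsto_mult_left_zero LIMSEQ_realpow_zero)
  qed
  have "(\<lambda>t. \<alpha> ^ Suc t * U (Suc t) - \<alpha> ^ t * U t) sums (0 - \<alpha> ^ 0 * U 0)"
    by (rule telescope_sums[OF lim])
  from sums_add[OF summable_sums[OF sumE] this]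
  have "(\<lambda>t. \<alpha> ^ t * ?l t) sums ((\<Sum>t. \<alpha> ^ t * E t) - u x)"
    unfolding defect by (simp add: algebra_simps U0)
  then show ?thesis unfolding J .
qed

end

lemma ambiguity_prob_algebra:
  assumes K: "\<And>t y. y \<in> X \<Longrightarrow> K t y \<in> ambiguity_set N p y (a t y)" and a: "a \<in> policies X A"
    and y: "y \<in> X"
  shows "K t y \<in> space (prob_algebra (count_space X))"
proof -
  obtain k where "k \<in> {1..N}" "K t y = p k y (a t y)"
    using K[OF y, of t] by (auto simp: ambiguity_set_def)
  moreover have "a t y \<in> A" using a y by (auto simp: policies_def)
  ultimately show ?thesis using p y by simp
qed

lemma path_laws_ne: "path_laws X N p x a \<noteq> {}"
  unfolding path_laws_def using N by (auto simp: ambiguity_set_def intro!: exI[of _ "\<lambda>t y. p 1 y (a t y)"])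

text \<open>
  \<open>discounted_return_defect\<close> compares the return with \<open>u x\<close>, where \<open>u y = max\<^sub>b q y b\<close>. Against the
  kernels minimizing the one-step cost no policy exceeds \<open>u\<close>, and the greedy policy attains
  at least \<open>u\<close> whatever the kernels.
\<close>

lemma value_fn_eq:
  assumes q: "\<And>y b. y \<in> X \<Longrightarrow> b \<in> A \<Longrightarrow> bellman q y b = q y b" and x: "x \<in> X"
  shows "value_fn X A r \<alpha> N p x = Max (q x ` A)"
proof -
  define u where "u y = Max (q y ` A)" for y
  define J where "J a P = (\<integral>\<omega>. (\<Sum>t. \<alpha> ^ t * r (\<omega> t) (a t (\<omega> t)) (\<omega> (Suc t))) \<partial>P)"
    for a :: "nat \<Rightarrow> 'x \<Rightarrow> 'a" and P
  define cost where "cost y b P = (\<Sum>z\<in>X. (r y b z + \<alpha> * u z) * measure P {z})" for y b P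
  have cost: "selection_cost X A r \<alpha> q y b (\<lambda>z. measure P {z}) = cost y b P" for y b P
    by (simp add: selection_cost_def cost_def u_def)
  have q_eq: "q y b = Min (cost y b ` ambiguity_set N p y b)" if "y \<in> X" "b \<in> A" for y b
    using q[OF that] by (simp add: bellman_def cost ambiguity_set_def image_image)
  have fin: "finite (ambiguity_set N p y b)" "ambiguity_set N p y b \<noteq> {}" for y b
    using N by (auto simp: ambiguity_set_def)
  have q_le: "q y b \<le> cost y b P" if "y \<in> X" "b \<in> A" "P \<in> ambiguity_set N p y b" for y b P
    unfolding q_eq[OF that(1,2)] using fin that by (intro Min_le) auto
  have q_att: "\<exists>P\<in>ambiguity_set N p y b. cost y b P = q y b" if "y \<in> X" "b \<in> A" for y b
    unfolding q_eq[OF that] using Min_in[of "cost y b ` ambiguity_set N p y b"] fin by fastforce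
  have u_ge: "q y b \<le> u y" if "b \<in> A" for y b unfolding u_def using finite_A that by auto
  have u_att: "\<exists>b\<in>A. q y b = u y" for y
    unfolding u_def using Max_in[of "q y ` A"] finite_A A_ne by fastforce
  have return_le: "J a (path_law X x K) \<le> u x"
    if a: "a \<in> policies X A" and K: "\<And>t y. y \<in> X \<Longrightarrow> K t y \<in> ambiguity_set N p y (a t y)"
      and le: "\<And>t y. y \<in> X \<Longrightarrow> cost y (a t y) (K t y) \<le> u y" for a K
  proof -
    have "J a (path_law X x K) - u x \<le> 0"
      unfolding J_def
    proof (rule sums_le[OF _ discounted_return_defect sums_zero])
      show "\<alpha> ^ t * (\<Sum>y\<in>X. measure (path_law X x K) {\<omega> \<in> space (path_law X x K). \<omega> t = y} *
            ((\<Sum>z\<in>X. (r y (a t y) z + \<alpha> * u z) * measure (K t y) {z}) - u y)) \<le> 0" for t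
        using le[of _ t] \<alpha> unfolding cost_def
        by (intro mult_nonneg_nonpos sum_nonpos) auto
    qed (use a x ambiguity_prob_algebra[of K a, OF K a] in auto)
    then show ?thesis by simp
  qed
  have return_ge: "u x \<le> J a (path_law X x K)"
    if a: "a \<in> policies X A" and K: "\<And>t y. y \<in> X \<Longrightarrow> K t y \<in> ambiguity_set N p y (a t y)"
      and ge: "\<And>t y. y \<in> X \<Longrightarrow> u y \<le> cost y (a t y) (K t y)" for a K
  proof -
    have "0 \<le> J a (path_law X x K) - u x"
      unfolding J_def
    proof (rule sums_le[OF _ sums_zero discounted_return_defect])
      show "0 \<le> \<alpha> ^ t * (\<Sum>y\<in>X. measure (path_law X x K) {\<omega> \<in> space (path_law X x K). \<omega> t = y} *
            ((\<Sum>z\<in>X. (r y (a t y) z + \<alpha> * u z) * measure (K t y) {z}) - u y))" for t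
        using ge[of _ t] \<alpha> unfolding cost_def
        by (intro mult_nonneg_nonneg sum_nonneg) auto
    qed (use a x ambiguity_prob_algebra[of K a, OF K a] in auto)
    then show ?thesis by simp
  qed
  have bdd: "bdd_below (J a ` path_laws X N p x a)" if a: "a \<in> policies X A" for a
  proof -
    \<comment> \<open>The constant solves c = - \<open>r_max\<close> + \<alpha> c. Taken as a
      constant function \<open>u\<close>, it has nonnegative one-step defects under every kernel, so
      it lies below all returns; a real infimum needs such a lower bound.\<close>
    define c where "c = - r_max / (1 - \<alpha>)"
    have c: "c - \<alpha> * c = - r_max"
    proof -
      have "c * (1 - \<alpha>) = - r_max" using \<alpha> by (simp add: c_def)
      then show ?thesis by (simp add: algebra_simps)
    qed
    have "c \<le> J a (path_law X x K)" if K: "\<And>t y. y \<in> X \<Longrightarrow> K t y \<in> ambiguity_set N p y (a t y)" for K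
    proof -
      have "0 \<le> J a (path_law X x K) - c"
        unfolding J_def
      proof (rule sums_le[OF _ sums_zero discounted_return_defect[where u="\<lambda>_. c"]])
        fix t
        have "c \<le> (\<Sum>z\<in>X. (r y (a t y) z + \<alpha> * c) * measure (K t y) {z})" if y: "y \<in> X" for y
        proof -
          obtain k where k: "k \<in> {1..N}" "K t y = p k y (a t y)"
            using K[OF y, of t] by (auto simp: ambiguity_set_def)
          have ay: "a t y \<in> A" using a y by (auto simp: policies_def)
          have "c = (\<Sum>z\<in>X. c * measure (K t y) {z})"
            using sum_kernel[OF k(1) y ay] by (simp add: k flip: sum_distrib_left)
          also have "\<dots> \<le> (\<Sum>z\<in>X. (r y (a t y) z + \<alpha> * c) * measure (K t y) {z})"
          proof (intro sum_mono mult_right_mono)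
            fix z assume "z \<in> X"
            then have "- r_max \<le> r y (a t y) z" using r_le[OF y ay] abs_le_D2 by fastforce
            with c show "c \<le> r y (a t y) z + \<alpha> * c" by linarith
          qed simp
          finally show ?thesis .
        qed
        then show "0 \<le> \<alpha> ^ t * (\<Sum>y\<in>X. measure (path_law X x K) {\<omega> \<in> space (path_law X x K). \<omega> t = y} *
            ((\<Sum>z\<in>X. (r y (a t y) z + \<alpha> * c) * measure (K t y) {z}) - c))"
          using \<alpha> by (intro mult_nonneg_nonneg sum_nonneg) auto
      qed (use a x ambiguity_prob_algebra[of K a, OF K a] in auto)
      then show ?thesis by simp
    qed
    then show ?thesis by (intro bdd_belowI[of _ c]) (auto simp: path_laws_def)
  qed
  have upper: "(INF P\<in>path_laws X N p x a. J a P) \<le> u x" if a: "a \<in> policies X A" for a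
  proof -
    have aA: "a t y \<in> A" if "y \<in> X" for t y using a that by (auto simp: policies_def)
    \<comment> \<open>Nature's reply to the given policy: at every time and state a kernel attaining
      the minimum that defines \<open>q\<close>. It need not be optimal over whole paths, only good
      enough to keep the return at or below \<open>u x\<close>.\<close>
    define K where "K t y = (SOME P. P \<in> ambiguity_set N p y (a t y) \<and> cost y (a t y) P = q y (a t y))" for t y
    have K: "K t y \<in> ambiguity_set N p y (a t y)" "cost y (a t y) (K t y) = q y (a t y)" if "y \<in> X" for t y
      using someI_ex[of "\<lambda>P. P \<in> ambiguity_set N p y (a t y) \<and> cost y (a t y) P = q y (a t y)"]
        q_att[OF that aA[OF that]] unfolding K_def by blast+
    have "(INF P\<in>path_laws X N p x a. J a P) \<le> J a (path_law X x K)"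
      using K by (intro cINF_lower bdd a) (auto simp: path_laws_def)
    also have "\<dots> \<le> u x" using K u_ge aA by (intro return_le a) auto
    finally show ?thesis .
  qed
  define greedy where "greedy = (\<lambda>(_::nat) y. SOME b. b \<in> A \<and> q y b = u y)"
  have greedy: "greedy t y \<in> A" "q y (greedy t y) = u y" for t y
    using someI_ex[of "\<lambda>b. b \<in> A \<and> q y b = u y"] u_att[of y] unfolding greedy_def by blast+
  have pol: "greedy \<in> policies X A" using greedy by (auto simp: policies_def)
  have lower: "u x \<le> (INF P\<in>path_laws X N p x greedy. J greedy P)"
  proof (rule cINF_greatest[OF path_laws_ne])
    fix P assume "P \<in> path_laws X N p x greedy"
    then obtain K where K: "P = path_law X x K" "\<And>t y. y \<in> X \<Longrightarrow> K t y \<in> ambiguity_set N p y (greedy t y)"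
      by (auto simp: path_laws_def)
    have "u y \<le> cost y (greedy t y) (K t y)" if "y \<in> X" for t y
      using q_le[OF that greedy(1) K(2)[OF that], of t] greedy(2)[of y t] by simp
    then show "u x \<le> J greedy P" unfolding K(1) using K(2) by (intro return_ge pol) auto
  qed
  have "(SUP a\<in>policies X A. INF P\<in>path_laws X N p x a. J a P) = u x"
  proof (rule antisym)
    show "(SUP a\<in>policies X A. INF P\<in>path_laws X N p x a. J a P) \<le> u x"
      using upper pol by (intro cSUP_least) auto
    \<comment> \<open>The bound \<open>upper\<close> serves a second time here: it makes the
      supremum over policies a genuine one.\<close>
    have "(INF P\<in>path_laws X N p x greedy. J greedy P) \<le> (SUP a\<in>policies X A. INF P\<in>path_laws X N p x a. J a P)"
      using upper by (intro cSUP_upper pol bdd_aboveI[of _ "u x"]) auto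
    with lower show "u x \<le> (SUP a\<in>policies X A. INF P\<in>path_laws X N p x a. J a P)" by linarith
  qed
  then show ?thesis by (simp add: value_fn_def J_def u_def)
qed

text \<open>\<open>robust_Q\<close> is one Bellman step applied to \<open>value_fn\<close>, and
  \<open>value_fn\<close> is the maximum over actions of a fixed point \<open>q\<close>; so
  \<open>robust_Q\<close> agrees with \<open>q\<close> on \<open>X\<close> and
  \<open>A\<close>.\<close>

lemma bellman_robust_Q:
  assumes x: "x \<in> X" "b \<in> A"
  shows "bellman (robust_Q X A r \<alpha> N p) x b = robust_Q X A r \<alpha> N p x b"
proof -
  obtain q where q: "\<And>y c. y \<in> X \<Longrightarrow> c \<in> A \<Longrightarrow> bellman q y c = q y c" using bellman_fixed_point by blast
  have eq: "robust_Q X A r \<alpha> N p y c = q y c" if y: "y \<in> X" "c \<in> A" for y c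
  proof -
    have "robust_Q X A r \<alpha> N p y c = bellman q y c"
      unfolding robust_Q_def bellman_def ambiguity_set_def image_image selection_cost_def
      by (intro arg_cong[where f=Min] image_cong refl)
        (use y in \<open>simp add: integral_kernel value_fn_eq[OF q] cong: sum.cong\<close>)
    then show ?thesis using q[OF y] by simp
  qed
  \<comment> \<open>The contraction with \<open>B = 0\<close>: the operator depends only on the
    values on \<open>X\<close> and \<open>A\<close>.\<close>
  have "bellman (robust_Q X A r \<alpha> N p) x b = bellman q x b"
    using bellman_contraction[of "robust_Q X A r \<alpha> N p" q 0 x b] eq x by simp
  then show ?thesis using q[OF x] eq[OF x] by simp
qed

end

section \<open>Visits, estimates and sampling noise\<close>

text \<open>A function determined by finitely many variables with finite range is constant on their
  joint level sets, so every preimage is a finite union of these. This makes recursively defined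
  path functionals measurable without following their recursion.\<close>

lemma measurable_finite_factor:
  fixes f :: "'w \<Rightarrow> real"
  assumes "finite I" "finite S" and Z: "\<And>i. i \<in> I \<Longrightarrow> Z i \<in> measurable F (count_space S)"
    and f: "\<And>\<omega> \<omega>'. \<omega> \<in> space F \<Longrightarrow> \<omega>' \<in> space F \<Longrightarrow> (\<And>i. i \<in> I \<Longrightarrow> Z i \<omega> = Z i \<omega>') \<Longrightarrow> f \<omega> = f \<omega>'"
  shows "f \<in> borel_measurable F"
proof (rule measurableI)
  fix B :: "real set"
  define W where "W = {z \<in> PiE I (\<lambda>_. S). \<exists>\<omega>\<in>space F. f \<omega> \<in> B \<and> (\<forall>i\<in>I. Z i \<omega> = z i)}"
  have "finite W" unfolding W_def using assms(1,2) by (intro finite_subset[OF _ finite_PiE]) auto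
  have "{\<omega> \<in> space F. \<forall>i\<in>I. Z i \<omega> = z i} \<in> sets F" if "z \<in> W" for z
  proof (intro sets.sets_Collect_finite_All \<open>finite I\<close>)
    fix i assume "i \<in> I"
    have "{\<omega> \<in> space F. Z i \<omega> = z i} = Z i -` {z i} \<inter> space F" by auto
    also have "\<dots> \<in> sets F"
      using that \<open>i \<in> I\<close> by (intro measurable_sets[OF Z]) (auto simp: W_def)
    finally show "{\<omega> \<in> space F. Z i \<omega> = z i} \<in> sets F" .
  qed
  then have "(\<Union>z\<in>W. {\<omega> \<in> space F. \<forall>i\<in>I. Z i \<omega> = z i}) \<in> sets F"
    using \<open>finite W\<close> by (intro sets.finite_UN) auto
  also have "(\<Union>z\<in>W. {\<omega> \<in> space F. \<forall>i\<in>I. Z i \<omega> = z i}) = f -` B \<inter> space F"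
  proof (intro set_eqI iffI)
    fix \<omega> assume "\<omega> \<in> f -` B \<inter> space F"
    then show "\<omega> \<in> (\<Union>z\<in>W. {\<omega> \<in> space F. \<forall>i\<in>I. Z i \<omega> = z i})"
    proof (intro UN_I[of "\<lambda>i\<in>I. Z i \<omega>"])
      have "Z i \<omega> \<in> S" if "i \<in> I" for i
        using measurable_space[OF Z[OF that], of \<omega>] \<open>\<omega> \<in> f -` B \<inter> space F\<close> by simp
      then show "(\<lambda>i\<in>I. Z i \<omega>) \<in> W"
        using \<open>\<omega> \<in> f -` B \<inter> space F\<close> unfolding W_def by (auto intro!: bexI[of _ \<omega>])
    qed (use \<open>\<omega> \<in> f -` B \<inter> space F\<close> in simp)
  next
    fix \<omega> assume "\<omega> \<in> (\<Union>z\<in>W. {\<omega> \<in> space F. \<forall>i\<in>I. Z i \<omega> = z i})"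
    then obtain z \<omega>' where *: "\<omega> \<in> space F" "\<forall>i\<in>I. Z i \<omega> = z i" "\<omega>' \<in> space F" "f \<omega>' \<in> B" "\<forall>i\<in>I. Z i \<omega>' = z i"
      by (auto simp: W_def)
    then have "f \<omega> = f \<omega>'" by (intro f) auto
    with * show "\<omega> \<in> f -` B \<inter> space F" by auto
  qed
  finally show "f -` B \<inter> space F \<in> sets F" .
qed auto

section \<open>Pathwise identities for visit counts, rates and estimates\<close>

lemma visits_cong: "(\<And>s. s \<le> t \<Longrightarrow> \<xi> s = \<xi>' s) \<Longrightarrow> visits a \<xi> t x b = visits a \<xi>' t x b"
  unfolding visits_def by (intro sum.cong) auto

lemma learning_rate_cong:
  "(\<And>s. s \<le> t \<Longrightarrow> \<xi> s = \<xi>' s) \<Longrightarrow> learning_rate a g \<xi> t x b = learning_rate a g \<xi>' t x b"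
  unfolding learning_rate_def using visits_cong[of t \<xi> \<xi>' a x b] by simp

text \<open>Adaptedness in pathwise form: the iterate at time \<open>t\<close> reads the path only
  up to \<open>t\<close>, which is what \<open>path_functional_past\<close> needs.\<close>

lemma Q_iter_cong:
  "(\<And>s. s \<le> t \<Longrightarrow> \<xi> s = \<xi>' s) \<Longrightarrow> Q_iter A r \<alpha> a g Q0 \<xi> t = Q_iter A r \<alpha> a g Q0 \<xi>' t"
proof (induction t)
  case (Suc t)
  then have "Q_iter A r \<alpha> a g Q0 \<xi> t = Q_iter A r \<alpha> a g Q0 \<xi>' t"
    and "learning_rate a g \<xi> t = learning_rate a g \<xi>' t"
    by (auto intro!: ext learning_rate_cong)
  then show ?case using Suc.prems[of "Suc t"] by simp
qed simp

lemma learning_rate_nonneg: "(\<And>n. 0 \<le> g n) \<Longrightarrow> 0 \<le> learning_rate a g \<xi> t x b"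
  and learning_rate_le_1: "(\<And>n. g n \<le> 1) \<Longrightarrow> learning_rate a g \<xi> t x b \<le> 1"
  by (auto simp: learning_rate_def)

lemma learning_rate_power2: "(learning_rate a g \<xi> t x b)\<^sup>2 = learning_rate a (\<lambda>n. (g n)\<^sup>2) \<xi> t x b"
  by (simp add: learning_rate_def)

lemma learning_rate_neq_0: "learning_rate a g \<xi> t x b \<noteq> 0 \<Longrightarrow> x = \<xi> t \<and> b = a t (\<xi> t)"
  by (simp add: learning_rate_def split: if_splits)

text \<open>The half-open variant of \<open>visits\<close>: it starts at 0 and matches partial sums
  over times below \<open>n\<close>, which suits induction.\<close>

definition visits_before :: "(nat \<Rightarrow> 'x \<Rightarrow> 'a) \<Rightarrow> (nat \<Rightarrow> 'x) \<Rightarrow> nat \<Rightarrow> 'x \<Rightarrow> 'a \<Rightarrow> nat" where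
  "visits_before a \<xi> n x b = (\<Sum>s<n. of_bool ((\<xi> s, a s (\<xi> s)) = (x, b)))"

lemma visits_before_Suc:
  "visits_before a \<xi> (Suc n) x b = visits_before a \<xi> n x b + of_bool ((\<xi> n, a n (\<xi> n)) = (x, b))"
  by (simp add: visits_before_def)

lemma visits_eq: "visits a \<xi> t x b = visits_before a \<xi> (Suc t) x b"
  by (simp add: visits_def visits_before_def lessThan_Suc_atMost del: sum.lessThan_Suc)

text \<open>The count includes the current visit, so the successive visits carry the rates
  \<open>f 1\<close>, \<open>f 2\<close> and so on, each once, and every other time contributes 0.
  The random series is the deterministic one run at the speed of the visits.\<close>

lemma sum_learning_rate:
  "(\<Sum>t<n. learning_rate a f \<xi> t x b) = (\<Sum>i=1..visits_before a \<xi> n x b. f i)"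
proof (induction n)
  case (Suc n)
  then show ?case
    by (auto simp: learning_rate_def visits_eq visits_before_Suc)
qed (simp add: visits_before_def)

text \<open>A discrete intermediate value property: the count starts at 0 and grows by at most 1 per
  step.\<close>

lemma visits_before_attains:
  assumes "m \<le> visits_before a \<xi> n x b"
  shows "\<exists>n. visits_before a \<xi> n x b = m"
  using assms
proof (induction n)
  case (Suc n)
  then show ?case
    by (cases "m \<le> visits_before a \<xi> n x b")
      (auto simp: visits_before_Suc of_bool_def split: if_splits intro!: exI[of _ "Suc n"])
qed (auto simp: visits_before_def)

text \<open>If some count were never attained, only finitely many rates could enter and their sum
  would be finite.\<close>

lemma visits_unbounded:
  assumes "\<And>n. 0 \<le> g n" "\<not> summable (\<lambda>t. learning_rate a g \<xi> t x b)"
  shows "\<exists>n. visits_before a \<xi> n x b = m"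
proof (rule ccontr)
  assume "\<not> ?thesis"
  then have le: "visits_before a \<xi> n x b \<le> m" for n
    using visits_before_attains[of m a \<xi> n x b] by force
  have "(\<Sum>t<n. learning_rate a g \<xi> t x b) \<le> (\<Sum>i=1..m. g i)" for n
    unfolding sum_learning_rate using le[of n] assms(1) by (intro sum_mono2) auto
  then have "summable (\<lambda>t. learning_rate a g \<xi> t x b)"
    using assms(1) by (intro summableI_nonneg_bounded) (auto intro: learning_rate_nonneg)
  with assms(2) show False ..
qed

text \<open>The partial sums of \<open>f\<close> from index 1 are partial sums of the random series,
  stopped once the pair has been visited often enough. With \<open>1 / n\<close> its contrapositive
  gives divergence along the path; with squared rates it gives a deterministic summability.\<close>

lemma summable_learning_rate_imp:
  assumes f: "\<And>n. 0 \<le> f n" and summ: "summable (\<lambda>t. learning_rate a f \<xi> t x b)"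
    and unb: "\<And>m. \<exists>n. visits_before a \<xi> n x b = m"
  shows "summable f"
proof -
  have "(\<Sum>i<m. f (Suc i)) \<le> (\<Sum>t. learning_rate a f \<xi> t x b)" for m
  proof -
    obtain n where n: "visits_before a \<xi> n x b = m" using unb by blast
    have "(\<Sum>i<m. f (Suc i)) = (\<Sum>i=1..m. f i)"
      by (simp add: sum.atLeast1_atMost_eq)
    also have "\<dots> = (\<Sum>t<n. learning_rate a f \<xi> t x b)" by (simp add: sum_learning_rate n)
    also have "\<dots> \<le> (\<Sum>t. learning_rate a f \<xi> t x b)"
      using f by (intro sum_le_suminf summ) (auto intro: learning_rate_nonneg)
    finally show ?thesis .
  qed
  then have "summable (\<lambda>i. f (Suc i))" by (intro summableI_nonneg_bounded f)
  then show ?thesis by (simp add: summable_Suc_iff)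
qed

lemma sum_learning_rate_le_suminf:
  assumes f: "\<And>n. 0 \<le> f n" "summable f"
  shows "(\<Sum>t<n. learning_rate a f \<xi> t x b) \<le> suminf f"
  unfolding sum_learning_rate using f by (intro sum_le_suminf) auto

lemma empirical_eq:
  "empirical X a \<xi> \<eta> n x b y =
     (if visits_before a \<xi> n x b = 0 then 1 / real (card X)
      else (\<Sum>s<n. of_bool ((\<xi> s, a s (\<xi> s), \<eta> (Suc s)) = (x, b, y))) / real (visits_before a \<xi> n x b))"
proof (induction n)
  case (Suc n)
  have *: "(\<Sum>s\<le>n. f s) = (\<Sum>s<Suc n. f s)" for f :: "nat \<Rightarrow> real"
    by (simp only: lessThan_Suc_atMost)
  show ?case
  proof (cases "visits_before a \<xi> (Suc n) x b = 0")
    case True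
    then have "visits_before a \<xi> n x b = 0" by (simp only: visits_before_Suc add_is_0)
    with True show ?thesis using Suc by (simp only: empirical.simps visits_eq if_True refl)
  next
    case False
    then show ?thesis by (simp only: empirical.simps visits_eq if_False *)
  qed
qed (simp add: visits_before_def)

text \<open>The running mean is updated with weight \<open>1 / n\<close> at the n-th visit and left
  alone otherwise. Subtracting a constant \<open>m\<close> preserves this form and centres the
  samples.\<close>

lemma empirical_Suc:
  fixes m :: real
  shows "empirical X a \<xi> \<eta> (Suc t) x b y - m
    = (1 - learning_rate a (\<lambda>n. 1 / real n) \<xi> t x b) * (empirical X a \<xi> \<eta> t x b y - m)
      + learning_rate a (\<lambda>n. 1 / real n) \<xi> t x b * (of_bool (\<eta> (Suc t) = y) - m)"
proof (cases "(\<xi> t, a t (\<xi> t)) = (x, b)")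
  case True
  then have xb: "x = \<xi> t" "b = a t (\<xi> t)" by auto
  define v where "v = visits_before a \<xi> t x b"
  define c where "c = (\<Sum>s<t. of_bool ((\<xi> s, a s (\<xi> s), \<eta> (Suc s)) = (x, b, y)) :: real)"
  have V: "visits_before a \<xi> (Suc t) x b = Suc v" by (simp add: visits_before_Suc v_def xb)
  have lr: "learning_rate a (\<lambda>n. 1 / real n) \<xi> t x b = 1 / real (Suc v)"
    using V unfolding xb by (simp add: learning_rate_def visits_eq)
  have e1: "empirical X a \<xi> \<eta> (Suc t) x b y = (c + of_bool (\<eta> (Suc t) = y)) / real (Suc v)"
    unfolding empirical_eq V using xb by (simp add: c_def)
  show ?thesis
  proof (cases "v = 0")
    \<comment> \<open>At the first visit the rate is 1, so the uniform initial weight is forgotten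
      completely.\<close>
    case True
    then have "c = 0"
      unfolding c_def v_def visits_before_def by (intro sum.neutral) auto
    then show ?thesis unfolding lr e1 using True by simp
  next
    case False
    then have e0: "empirical X a \<xi> \<eta> t x b y = c / real v" by (simp add: empirical_eq c_def v_def)
    have A: "1 - 1 / real (Suc v) = real v / real (Suc v)" by (simp add: field_simps)
    have B: "real v / real (Suc v) * (c / real v - m) = (c - real v * m) / real (Suc v)"
      using False by (simp add: right_diff_distrib diff_divide_distrib)
    have C: "(c - (S - 1) * m) / S + 1 / S * (d - m) = (c + d) / S - m" if "S \<noteq> 0" for S d
      using that by (simp add: field_simps)
    show ?thesis
      unfolding lr e1 e0 A B using C[of "real (Suc v)" "of_bool (\<eta> (Suc t) = y)"] by simp
  qed
next
  case False
  have "visits_before a \<xi> (Suc t) x b = visits_before a \<xi> t x b"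
    unfolding visits_before_Suc using False by (simp only: of_bool_def if_False add_0_right)
  moreover have "of_bool ((\<xi> t, a t (\<xi> t), \<eta> (Suc t)) = (x, b, y)) = (0 :: real)"
    using False by auto
  moreover have "(x, b) \<noteq> (\<xi> t, a t (\<xi> t))" using False by metis
  then have "learning_rate a (\<lambda>n. 1 / real n) \<xi> t x b = 0"
    by (simp only: learning_rate_def of_bool_def if_False mult_zero_left)
  ultimately show ?thesis unfolding empirical_eq
    by (simp only: sum.lessThan_Suc diff_zero mult_1 mult_zero_left add_0_right)
qed

section \<open>The filtration of a run and the convergence of its sampling noise\<close>

locale robust_Q_run = robust_mdp X A r \<alpha> N p
  for X :: "'x set" and A :: "'a set" and r \<alpha> N p +
  fixes x0 a g Q0 and M :: "'w measure" and Xs Y \<kappa>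
  assumes g: "\<And>n. g n \<in> {0..1::real}" and x0: "x0 \<in> X" and a: "a \<in> policies X A"
    and run: "robust_Q_learning X A r \<alpha> N p x0 a g Q0 M Xs Y \<kappa>"
begin

sublocale prob_space M
  using run by (simp add: robust_Q_learning_def)

abbreviation "\<F> \<equiv> past M N Xs Y \<kappa>"

lemma a_in: "x \<in> X \<Longrightarrow> a t x \<in> A"
  using a by (auto simp: policies_def)

lemma Y_measurable: "k \<in> {1..N} \<Longrightarrow> Y k (Suc t) \<in> measurable M (count_space X)"
  and \<kappa>_measurable: "\<kappa> t \<in> measurable M (count_space {1..N})"
  and Xs_0: "\<omega> \<in> space M \<Longrightarrow> Xs 0 \<omega> = x0"
  and Xs_Suc: "\<omega> \<in> space M \<Longrightarrow> Xs (Suc t) \<omega> = Y (\<kappa> t \<omega>) (Suc t) \<omega>"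
  using run by (auto simp: robust_Q_learning_def)

lemma \<kappa>_in: "\<omega> \<in> space M \<Longrightarrow> \<kappa> t \<omega> \<in> {1..N}"
  using measurable_space[OF \<kappa>_measurable[of t]] by simp

lemma Y_in: "k \<in> {1..N} \<Longrightarrow> \<omega> \<in> space M \<Longrightarrow> Y k (Suc t) \<omega> \<in> X"
  using measurable_space[OF Y_measurable] by simp

lemma Xs_measurable: "Xs t \<in> measurable M (count_space X)"
proof (cases t)
  case 0
  have "(\<lambda>_. x0) \<in> measurable M (count_space X)" using x0 by simp
  then show ?thesis using 0 Xs_0 by (simp cong: measurable_cong)
next
  case (Suc s)
  have "(\<lambda>\<omega>. Y (\<kappa> s \<omega>) (Suc s) \<omega>) \<in> measurable M (count_space X)"
    by (rule measurable_compose_countable'[OF Y_measurable \<kappa>_measurable]) auto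
  then show ?thesis using Suc Xs_Suc by (simp cong: measurable_cong)
qed

lemma Xs_in: "\<omega> \<in> space M \<Longrightarrow> Xs t \<omega> \<in> X"
  using measurable_space[OF Xs_measurable[of t]] by simp

definition past_gen :: "nat \<Rightarrow> 'w set set" where
  "past_gen t = {Xs s -` {y} \<inter> space M | s y. s \<le> t}
      \<union> {Y k s -` {y} \<inter> space M | k s y. k \<in> {1..N} \<and> s \<in> {1..t}}
      \<union> {\<kappa> s -` {k} \<inter> space M | s k. s \<le> t}"

lemma vimage_count_space:
  assumes "f \<in> measurable M (count_space S)"
  shows "f -` {y} \<inter> space M \<in> sets M"
proof -
  have "f -` {y} \<inter> space M = f -` ({y} \<inter> S) \<inter> space M"
    using measurable_space[OF assms] by auto
  also have "\<dots> \<in> sets M" by (rule measurable_sets[OF assms]) simp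
  finally show ?thesis .
qed

lemma past_gen_sets: "past_gen t \<subseteq> sets M"
proof -
  have "Y k s -` {y} \<inter> space M \<in> sets M" if "k \<in> {1..N}" "s \<in> {1..t}" for k s y
    using vimage_count_space[OF Y_measurable[OF that(1), of "s - 1"]] that by simp
  then show ?thesis
    using vimage_count_space[OF Xs_measurable] vimage_count_space[OF \<kappa>_measurable]
    by (auto simp: past_gen_def)
qed

lemma space_past: "space (\<F> t) = space M"
  and sets_past: "sets (\<F> t) = sigma_sets (space M) (past_gen t)"
proof -
  have "past_gen t \<subseteq> Pow (space M)" using past_gen_sets sets.sets_into_space by blast
  then show "space (\<F> t) = space M" "sets (\<F> t) = sigma_sets (space M) (past_gen t)"
    unfolding past_def past_gen_def[symmetric] by (simp_all add: space_measure_of sets_measure_of)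
qed

lemma past_gen_in: "S \<in> past_gen t \<Longrightarrow> S \<in> sets (\<F> t)"
  unfolding sets_past by (rule sigma_sets.Basic)

lemma subalgebra_past: "subalgebra M (\<F> t)"
  using sets.sigma_sets_subset[OF past_gen_sets] by (simp add: subalgebra_def space_past sets_past)

lemma past_Suc: "sets (\<F> t) \<subseteq> sets (\<F> (Suc t))"
proof -
  have "{1..t} \<subseteq> {1..Suc t}" by auto
  then have "past_gen t \<subseteq> past_gen (Suc t)"
    unfolding past_gen_def by (intro Un_mono) (blast intro: le_SucI)+
  then show ?thesis unfolding sets_past by (rule sigma_sets_mono')
qed

lemma past_measurableI:
  assumes "finite S" "\<And>\<omega>. \<omega> \<in> space M \<Longrightarrow> f \<omega> \<in> S" "\<And>y. y \<in> S \<Longrightarrow> f -` {y} \<inter> space M \<in> past_gen t"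
  shows "f \<in> measurable (\<F> t) (count_space S)"
  using assms by (auto simp: measurable_count_space_eq2 space_past intro!: past_gen_in)

lemma Xs_past: "s \<le> t \<Longrightarrow> Xs s \<in> measurable (\<F> t) (count_space X)"
  by (intro past_measurableI finite_X Xs_in, assumption) (unfold past_gen_def, blast)

lemma \<kappa>_past: "s \<le> t \<Longrightarrow> \<kappa> s \<in> measurable (\<F> t) (count_space {1..N})"
  by (intro past_measurableI finite_atLeastAtMost \<kappa>_in, assumption) (unfold past_gen_def, blast)

lemma Y_past:
  assumes "k \<in> {1..N}" "s < t"
  shows "Y k (Suc s) \<in> measurable (\<F> t) (count_space X)"
proof (intro past_measurableI finite_X Y_in assms)
  have "Suc s \<in> {1..t}" using assms by auto
  then show "Y k (Suc s) -` {y} \<inter> space M \<in> past_gen t" for y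
    unfolding past_gen_def using assms(1) by blast
qed

lemma past_measurable_mono: "f \<in> measurable (\<F> t) N' \<Longrightarrow> f \<in> measurable (\<F> (Suc t)) N'"
  using past_Suc by (intro measurable_from_subalg[of "\<F> (Suc t)" "\<F> t"]) (auto simp: subalgebra_def space_past)

lemma past_measurable_M: "f \<in> measurable (\<F> t) N' \<Longrightarrow> f \<in> measurable M N'"
  by (rule measurable_from_subalg[OF subalgebra_past])

lemma path_functional_past:
  fixes f :: "(nat \<Rightarrow> 'x) \<Rightarrow> real"
  assumes "\<And>\<xi> \<xi>'. (\<And>s. s \<le> t \<Longrightarrow> \<xi> s = \<xi>' s) \<Longrightarrow> f \<xi> = f \<xi>'"
  shows "(\<lambda>\<omega>. f (\<lambda>s. Xs s \<omega>)) \<in> borel_measurable (\<F> t)"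
proof (rule measurable_finite_factor[of "{..t}" X Xs])
  show "f (\<lambda>s. Xs s \<omega>) = f (\<lambda>s. Xs s \<omega>')" if "\<And>i. i \<in> {..t} \<Longrightarrow> Xs i \<omega> = Xs i \<omega>'" for \<omega> \<omega>'
    using that by (intro assms) simp
qed (simp_all add: finite_X Xs_past)

lemma kernel_past:
  assumes "K \<in> measurable (\<F> t) (count_space {1..N})"
  shows "(\<lambda>\<omega>. measure (p (K \<omega>) (Xs t \<omega>) (a t (Xs t \<omega>))) {y}) \<in> borel_measurable (\<F> t)"
proof (rule measurable_compose_countable'[OF _ assms])
  fix k
  show "(\<lambda>\<omega>. measure (p k (Xs t \<omega>) (a t (Xs t \<omega>))) {y}) \<in> borel_measurable (\<F> t)"
    by (rule measurable_compose_countable'[OF _ Xs_past[OF order_refl]])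
      (auto simp: countable_finite finite_X)
qed auto

text \<open>The algorithm prescribes the conditional law only of the whole vector of samples.
  Summing over all vectors with k-th entry \<open>y\<close> leaves the k-th weight, since the
  weights of each other kernel add up to 1.\<close>

lemma sample_marginal:
  assumes k: "k \<in> {1..N}" and y: "y \<in> X" and G: "G \<in> borel_measurable (\<F> t)"
    and Gb: "\<And>\<omega>. \<omega> \<in> space M \<Longrightarrow> \<bar>G \<omega>\<bar> \<le> B"
  shows "expectation (\<lambda>\<omega>. G \<omega> * of_bool (Y k (Suc t) \<omega> = y))
      = expectation (\<lambda>\<omega>. G \<omega> * measure (p k (Xs t \<omega>) (a t (Xs t \<omega>))) {y})"
proof -
  interpret S: finite_measure_subalgebra M "\<F> t"
    by unfold_locales (rule subalgebra_past)
  have [measurable]: "G \<in> borel_measurable M" by (rule past_measurable_M[OF G])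
  \<comment> \<open>The events \<open>E z\<close> with \<open>z\<close> in \<open>Z\<close>
    partition the event that the k-th sample is \<open>y\<close>; extensionality makes the vector
    describing an outcome unique.\<close>
  define Z where "Z = PiE {1..N} (\<lambda>j. if j = k then {y} else X)"
  define E where "E z = {\<omega> \<in> space M. \<forall>k\<in>{1..N}. Y k (Suc t) \<omega> = z k}" for z
  have finZ: "finite Z" unfolding Z_def by (intro finite_PiE) (auto simp: finite_X)
  have ZX: "z \<in> {1..N} \<rightarrow> X" if "z \<in> Z" for z
    using that y by (fastforce simp: Z_def PiE_iff split: if_splits)
  have E [measurable]: "E z \<in> sets M" for z
    unfolding E_def
  proof (intro sets.sets_Collect_finite_All)
    fix j assume "j \<in> {1..N}"
    have "{\<omega> \<in> space M. Y j (Suc t) \<omega> = z j} = Y j (Suc t) -` {z j} \<inter> space M" by auto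
    then show "{\<omega> \<in> space M. Y j (Suc t) \<omega> = z j} \<in> sets M"
      using vimage_count_space[OF Y_measurable[OF \<open>j \<in> {1..N}\<close>]] by simp
  qed simp
  have eq: "of_bool (Y k (Suc t) \<omega> = y) = (\<Sum>z\<in>Z. indicator (E z) \<omega> :: real)" if \<omega>: "\<omega> \<in> space M" for \<omega>
  proof -
    define z0 where "z0 = (\<lambda>j\<in>{1..N}. Y j (Suc t) \<omega>)"
    have "\<omega> \<in> E z \<longleftrightarrow> z = z0" if "z \<in> Z" for z
      using \<omega> that by (auto simp: E_def z0_def Z_def PiE_iff extensional_def fun_eq_iff)
    then have "(\<Sum>z\<in>Z. indicator (E z) \<omega> :: real) = (\<Sum>z\<in>Z. of_bool (z = z0))"
      by (intro sum.cong) (auto simp: indicator_def)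
    also have "\<dots> = of_bool (z0 \<in> Z)" using finZ by (simp add: of_bool_def)
    also have "z0 \<in> Z \<longleftrightarrow> Y k (Suc t) \<omega> = y"
      using k Y_in[OF _ \<omega>] by (auto simp: z0_def Z_def PiE_iff split: if_splits)
    finally show ?thesis by simp
  qed
  have intE: "integrable M (\<lambda>\<omega>. G \<omega> * indicator (E z) \<omega>)" for z
    using Gb by (intro integrable_const_bound[where B="\<bar>B\<bar>"]) (force simp: abs_mult indicator_def)+
  define m where "m \<omega> j v = measure (p j (Xs t \<omega>) (a t (Xs t \<omega>))) {v}" for \<omega> j v
  have AEc: "AE \<omega> in M. \<forall>z\<in>Z. real_cond_exp M (\<F> t) (indicator (E z)) \<omega> = (\<Prod>j\<in>{1..N}. m \<omega> j (z j))"
    unfolding E_def m_def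
    by (rule AE_finite_allI[OF finZ]) (use run ZX in \<open>auto simp: robust_Q_learning_def\<close>)
  have prod: "(\<Sum>z\<in>Z. \<Prod>j\<in>{1..N}. m \<omega> j (z j)) = m \<omega> k y" if \<omega>: "\<omega> \<in> space M" for \<omega>
  proof -
    have "(\<Sum>z\<in>Z. \<Prod>j\<in>{1..N}. m \<omega> j (z j)) = (\<Prod>j\<in>{1..N}. \<Sum>v\<in>(if j = k then {y} else X). m \<omega> j v)"
      unfolding Z_def by (rule prod_sum_PiE[symmetric]) (auto simp: finite_X)
    also have "\<dots> = (\<Prod>j\<in>{1..N}. if j = k then m \<omega> k y else 1)"
      using sum_kernel Xs_in[OF \<omega>] a_in by (intro prod.cong) (auto simp: m_def)
    also have "\<dots> = m \<omega> k y" using k by (simp add: prod.delta)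
    finally show ?thesis .
  qed
  have "expectation (\<lambda>\<omega>. G \<omega> * of_bool (Y k (Suc t) \<omega> = y))
      = expectation (\<lambda>\<omega>. \<Sum>z\<in>Z. G \<omega> * indicator (E z) \<omega>)"
    by (intro Bochner_Integration.integral_cong refl) (simp add: eq sum_distrib_left)
  also have "\<dots> = (\<Sum>z\<in>Z. expectation (\<lambda>\<omega>. G \<omega> * indicator (E z) \<omega>))"
    by (intro Bochner_Integration.integral_sum intE)
  also have "\<dots> = (\<Sum>z\<in>Z. expectation (\<lambda>\<omega>. G \<omega> * real_cond_exp M (\<F> t) (indicator (E z)) \<omega>))"
    by (intro sum.cong refl S.real_cond_exp_intg(2)[symmetric] intE G) auto
  also have "\<dots> = expectation (\<lambda>\<omega>. \<Sum>z\<in>Z. G \<omega> * real_cond_exp M (\<F> t) (indicator (E z)) \<omega>)"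
    by (intro Bochner_Integration.integral_sum[symmetric] S.real_cond_exp_intg(1) intE G) auto
  also have "\<dots> = expectation (\<lambda>\<omega>. G \<omega> * m \<omega> k y)"
  proof (rule integral_cong_AE)
    have "(\<lambda>\<omega>. m \<omega> k y) \<in> borel_measurable M"
      unfolding m_def using k by (intro past_measurable_M[OF kernel_past]) auto
    then show "(\<lambda>\<omega>. G \<omega> * m \<omega> k y) \<in> borel_measurable M" by simp
    show "AE \<omega> in M. (\<Sum>z\<in>Z. G \<omega> * real_cond_exp M (\<F> t) (indicator (E z)) \<omega>) = G \<omega> * m \<omega> k y"
      using AEc AE_space
    proof eventually_elim
      case (elim \<omega>)
      then have "(\<Sum>z\<in>Z. G \<omega> * real_cond_exp M (\<F> t) (indicator (E z)) \<omega>)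
          = G \<omega> * (\<Sum>z\<in>Z. \<Prod>j\<in>{1..N}. m \<omega> j (z j))"
        unfolding sum_distrib_left by (intro sum.cong) auto
      then show ?case using prod[OF elim(2)] by (simp only:)
    qed
  qed simp
  finally show ?thesis by (simp add: m_def)
qed

text \<open>A random index known from the past is no harder than a fixed one: split over its
  finitely many values and absorb each indicator into the test function \<open>G\<close>.\<close>

lemma sample_marginal_index:
  assumes K: "K \<in> measurable (\<F> t) (count_space {1..N})" and y: "y \<in> X" and G: "G \<in> borel_measurable (\<F> t)"
    and Gb: "\<And>\<omega>. \<omega> \<in> space M \<Longrightarrow> \<bar>G \<omega>\<bar> \<le> B"
  shows "expectation (\<lambda>\<omega>. G \<omega> * (of_bool (Y (K \<omega>) (Suc t) \<omega> = y)
      - measure (p (K \<omega>) (Xs t \<omega>) (a t (Xs t \<omega>))) {y})) = 0"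
proof -
  have [measurable]: "G \<in> borel_measurable M" by (rule past_measurable_M[OF G])
  let ?G = "\<lambda>k \<omega>. G \<omega> * of_bool (K \<omega> = k)"
  let ?m = "\<lambda>k \<omega>. measure (p k (Xs t \<omega>) (a t (Xs t \<omega>))) {y}"
  have Kin: "K \<omega> \<in> {1..N}" if "\<omega> \<in> space M" for \<omega>
    using measurable_space[OF K] that by (simp add: space_past)
  have GF: "?G k \<in> borel_measurable (\<F> t)" for k
  proof -
    have "(\<lambda>\<omega>. of_bool (K \<omega> = k) :: real) \<in> borel_measurable (\<F> t)"
      by (rule measurable_compose[OF K]) simp
    with G show ?thesis by (rule borel_measurable_times)
  qed
  have Gb': "\<bar>?G k \<omega>\<bar> \<le> \<bar>B\<bar>" if "\<omega> \<in> space M" for k \<omega>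
    using Gb[OF that] by (auto simp: of_bool_def)
  have Ym: "(\<lambda>\<omega>. of_bool (Y k (Suc t) \<omega> = y) :: real) \<in> borel_measurable M" if "k \<in> {1..N}" for k
    by (rule measurable_compose[OF Y_measurable[OF that]]) simp
  have m1: "?m k \<omega> \<le> 1" if "k \<in> {1..N}" "\<omega> \<in> space M" for k \<omega>
    using prob_space.prob_le_1[OF prob_kernel[OF that(1) Xs_in[OF that(2)] a_in[OF Xs_in[OF that(2)]]]] .
  have i1: "integrable M (\<lambda>\<omega>. ?G k \<omega> * of_bool (Y k (Suc t) \<omega> = y))" if "k \<in> {1..N}" for k
  proof (rule integrable_const_bound[where B="\<bar>B\<bar>"])
    show "AE \<omega> in M. norm (?G k \<omega> * of_bool (Y k (Suc t) \<omega> = y)) \<le> \<bar>B\<bar>"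
      using Gb'[of _ k] by (intro AE_I2) (auto simp: of_bool_def)
    show "(\<lambda>\<omega>. ?G k \<omega> * of_bool (Y k (Suc t) \<omega> = y)) \<in> borel_measurable M"
      by (rule borel_measurable_times[OF past_measurable_M[OF GF] Ym[OF that]])
  qed
  have i2: "integrable M (\<lambda>\<omega>. ?G k \<omega> * ?m k \<omega>)" if "k \<in> {1..N}" for k
  proof (rule integrable_const_bound[where B="\<bar>B\<bar> * 1"], rule AE_I2)
    show "norm (?G k \<omega> * ?m k \<omega>) \<le> \<bar>B\<bar> * 1" if "\<omega> \<in> space M" for \<omega>
      unfolding real_norm_def abs_mult[of "?G k \<omega>"]
      using Gb'[OF that, of k] m1[OF \<open>k \<in> {1..N}\<close> that] by (intro mult_mono) auto
    have "?m k \<in> borel_measurable M" using that by (intro past_measurable_M[OF kernel_past]) auto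
    then show "(\<lambda>\<omega>. ?G k \<omega> * ?m k \<omega>) \<in> borel_measurable M"
      by (rule borel_measurable_times[OF past_measurable_M[OF GF]])
  qed
  have "expectation (\<lambda>\<omega>. G \<omega> * (of_bool (Y (K \<omega>) (Suc t) \<omega> = y) - ?m (K \<omega>) \<omega>))
      = expectation (\<lambda>\<omega>. \<Sum>k\<in>{1..N}. ?G k \<omega> * of_bool (Y k (Suc t) \<omega> = y) - ?G k \<omega> * ?m k \<omega>)"
  proof (intro Bochner_Integration.integral_cong refl)
    fix \<omega> assume "\<omega> \<in> space M"
    have "(\<Sum>k\<in>{1..N}. ?G k \<omega> * of_bool (Y k (Suc t) \<omega> = y) - ?G k \<omega> * ?m k \<omega>)
        = (\<Sum>k\<in>{1..N}. if k = K \<omega> then G \<omega> * (of_bool (Y k (Suc t) \<omega> = y) - ?m k \<omega>) else 0)"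
      by (intro sum.cong) (auto simp: right_diff_distrib)
    also have "\<dots> = G \<omega> * (of_bool (Y (K \<omega>) (Suc t) \<omega> = y) - ?m (K \<omega>) \<omega>)"
      using Kin[OF \<open>\<omega> \<in> space M\<close>] by simp
    finally show "G \<omega> * (of_bool (Y (K \<omega>) (Suc t) \<omega> = y) - ?m (K \<omega>) \<omega>)
        = (\<Sum>k\<in>{1..N}. ?G k \<omega> * of_bool (Y k (Suc t) \<omega> = y) - ?G k \<omega> * ?m k \<omega>)" ..
  qed
  also have "\<dots> = (\<Sum>k\<in>{1..N}. expectation (\<lambda>\<omega>. ?G k \<omega> * of_bool (Y k (Suc t) \<omega> = y))
      - expectation (\<lambda>\<omega>. ?G k \<omega> * ?m k \<omega>))"
    using i1 i2 by (subst Bochner_Integration.integral_sum) (auto intro!: sum.cong)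
  also have "\<dots> = 0"
    using sample_marginal[OF _ y GF Gb'] by simp
  finally show ?thesis .
qed

text \<open>One statement for both sources of noise. A constant index, rates \<open>1 / n\<close>
  and an indicator as \<open>h\<close> give the noise of an estimate; the index
  \<open>\<kappa>\<close>, rates \<open>g\<close> and the update target give the noise of the
  iterates. The second moments are summable because along every path the squared rates are distinct
  terms of one convergent series.\<close>

lemma noise_convergent:
  fixes h :: "nat \<Rightarrow> 'x \<Rightarrow> 'w \<Rightarrow> real" and f :: "nat \<Rightarrow> real"
  assumes f: "\<And>n. 0 \<le> f n" "\<And>n. f n \<le> 1" "summable (\<lambda>n. (f n)\<^sup>2)"
    and K: "\<And>t. K t \<in> measurable (\<F> t) (count_space {1..N})"
    and h: "\<And>t y. y \<in> X \<Longrightarrow> h t y \<in> borel_measurable (\<F> t)"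
    and hb: "\<And>t y \<omega>. y \<in> X \<Longrightarrow> \<omega> \<in> space M \<Longrightarrow> \<bar>h t y \<omega>\<bar> \<le> C"
  shows "AE \<omega> in M. convergent (\<lambda>n. \<Sum>t<n. learning_rate a f (\<lambda>s. Xs s \<omega>) t x b *
      (\<Sum>y\<in>X. h t y \<omega> * (of_bool (Y (K t \<omega>) (Suc t) \<omega> = y)
         - measure (p (K t \<omega>) (Xs t \<omega>) (a t (Xs t \<omega>))) {y})))"
proof -
  let ?lr = "\<lambda>t \<omega>. learning_rate a f (\<lambda>s. Xs s \<omega>) t x b"
  let ?m = "\<lambda>t y \<omega>. measure (p (K t \<omega>) (Xs t \<omega>) (a t (Xs t \<omega>))) {y}"
  let ?d = "\<lambda>t y \<omega>. of_bool (Y (K t \<omega>) (Suc t) \<omega> = y) - ?m t y \<omega>"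
  define D where "D t \<omega> = ?lr t \<omega> * (\<Sum>y\<in>X. h t y \<omega> * ?d t y \<omega>)" for t \<omega>
  have lr: "?lr t \<in> borel_measurable (\<F> t)" for t
    by (rule path_functional_past[where f="\<lambda>\<xi>. learning_rate a f \<xi> t x b"]) (rule learning_rate_cong)
  have lr01: "0 \<le> ?lr t \<omega>" "?lr t \<omega> \<le> 1" for t \<omega>
    using f by (auto intro: learning_rate_nonneg learning_rate_le_1)
  have C: "0 \<le> C" using hb X_ne not_empty by (meson abs_ge_zero all_not_in_conv order_trans)
  have Kin: "K t \<omega> \<in> {1..N}" if "\<omega> \<in> space M" for t \<omega>
    using measurable_space[OF K] that by (simp add: space_past)
  have m1: "?m t y \<omega> \<le> 1" if "\<omega> \<in> space M" for t y \<omega>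
    using prob_space.prob_le_1[OF prob_kernel[OF Kin[OF that] Xs_in[OF that] a_in[OF Xs_in[OF that]]]] .
  have d1: "\<bar>?d t y \<omega>\<bar> \<le> 1" if "\<omega> \<in> space M" for t y \<omega>
    using m1[OF that, of t y] measure_nonneg[of "p (K t \<omega>) (Xs t \<omega>) (a t (Xs t \<omega>))" "{y}"] by (auto simp: of_bool_def)
  have dm: "?d t y \<in> borel_measurable (\<F> (Suc t))" for t y
  proof (rule borel_measurable_diff[OF _ past_measurable_mono[OF kernel_past[OF K]]])
    have "(\<lambda>\<omega>. Y (K t \<omega>) (Suc t) \<omega>) \<in> measurable (\<F> (Suc t)) (count_space X)"
      by (rule measurable_compose_countable'[OF Y_past past_measurable_mono[OF K]]) auto
    then show "(\<lambda>\<omega>. of_bool (Y (K t \<omega>) (Suc t) \<omega> = y) :: real) \<in> borel_measurable (\<F> (Suc t))"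
      by (rule measurable_compose) simp
  qed
  have Dm: "D t \<in> borel_measurable (\<F> (Suc t))" for t
    unfolding D_def by (intro borel_measurable_times borel_measurable_sum dm past_measurable_mono lr h)
  have sb: "\<bar>\<Sum>y\<in>X. h t y \<omega> * ?d t y \<omega>\<bar> \<le> C * card X" if \<omega>: "\<omega> \<in> space M" for t \<omega>
  proof -
    have "\<bar>\<Sum>y\<in>X. h t y \<omega> * ?d t y \<omega>\<bar> \<le> (\<Sum>y\<in>X. C * 1)"
      unfolding abs_mult
      by (rule order_trans[OF sum_abs], unfold abs_mult, intro sum_mono mult_mono hb[OF _ \<omega>] d1[OF \<omega>] C) auto
    then show ?thesis by (simp add: mult.commute)
  qed
  have Db': "\<bar>D t \<omega>\<bar> \<le> ?lr t \<omega> * (C * card X)" if \<omega>: "\<omega> \<in> space M" for t \<omega>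
    unfolding D_def abs_mult using sb[OF \<omega>] lr01 by (auto intro!: mult_mono)
  have Db: "\<bar>D t \<omega>\<bar> \<le> C * card X" if \<omega>: "\<omega> \<in> space M" for t \<omega>
  proof -
    have "?lr t \<omega> * (C * card X) \<le> 1 * (C * card X)" using C lr01(2) by (intro mult_right_mono) auto
    with Db'[OF \<omega>, of t] show ?thesis by simp
  qed
  have orth: "expectation (\<lambda>\<omega>. G \<omega> * D t \<omega>) = 0"
    if G: "G \<in> borel_measurable (\<F> t)" and Gb: "\<And>\<omega>. \<omega> \<in> space M \<Longrightarrow> \<bar>G \<omega>\<bar> \<le> B" for t G B
  proof -
    \<comment> \<open>All factors known at time \<open>t\<close> are collected into one bounded test
      function for each \<open>y\<close>, so that orthogonality follows summand by summand.\<close>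
    let ?H = "\<lambda>y \<omega>. G \<omega> * ?lr t \<omega> * h t y \<omega>"
    have HF: "?H y \<in> borel_measurable (\<F> t)" if "y \<in> X" for y
      using that by (intro borel_measurable_times G lr h)
    have Hb: "\<bar>?H y \<omega>\<bar> \<le> \<bar>B\<bar> * 1 * C" if "y \<in> X" "\<omega> \<in> space M" for y \<omega>
      unfolding abs_mult using Gb[OF that(2)] lr01[of \<omega> t] hb[OF that, of t] by (intro mult_mono) auto
    have int: "integrable M (\<lambda>\<omega>. ?H y \<omega> * ?d t y \<omega>)" if "y \<in> X" for y
    proof (rule integrable_const_bound[where B="(\<bar>B\<bar> * 1 * C) * 1"], rule AE_I2)
      show "norm (?H y \<omega> * ?d t y \<omega>) \<le> (\<bar>B\<bar> * 1 * C) * 1" if "\<omega> \<in> space M" for \<omega>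
        unfolding real_norm_def abs_mult[of "?H y \<omega>"]
        by (rule mult_mono[OF Hb[OF \<open>y \<in> X\<close> that] d1[OF that]]) (use C in auto)
      show "(\<lambda>\<omega>. ?H y \<omega> * ?d t y \<omega>) \<in> borel_measurable M"
        by (rule borel_measurable_times[OF past_measurable_M[OF HF[OF that]] past_measurable_M[OF dm]])
    qed
    have "expectation (\<lambda>\<omega>. G \<omega> * D t \<omega>) = expectation (\<lambda>\<omega>. \<Sum>y\<in>X. ?H y \<omega> * ?d t y \<omega>)"
      by (intro Bochner_Integration.integral_cong refl) (simp add: D_def sum_distrib_left mult.assoc)
    also have "\<dots> = (\<Sum>y\<in>X. expectation (\<lambda>\<omega>. ?H y \<omega> * ?d t y \<omega>))"
      by (intro Bochner_Integration.integral_sum int)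
    also have "\<dots> = 0"
      by (intro sum.neutral ballI sample_marginal_index[OF K _ HF Hb])
    finally show ?thesis .
  qed
  have [measurable]: "D t \<in> borel_measurable M" for t by (rule past_measurable_M[OF Dm])
  have D2: "integrable M (\<lambda>\<omega>. (D t \<omega>)\<^sup>2)" for t
    using Db C
    by (intro integrable_const_bound[where B="(C * card X)\<^sup>2"])
      (auto intro!: AE_I2 abs_le_square_iff[THEN iffD1])
  have "summable (\<lambda>t. expectation (\<lambda>\<omega>. (D t \<omega>)\<^sup>2))"
  proof (rule summableI_nonneg_bounded)
    fix n
    have "(\<Sum>t<n. expectation (\<lambda>\<omega>. (D t \<omega>)\<^sup>2)) = expectation (\<lambda>\<omega>. \<Sum>t<n. (D t \<omega>)\<^sup>2)"
      using D2 by simp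
    also have "\<dots> \<le> expectation (\<lambda>\<omega>. (C * card X)\<^sup>2 * (\<Sum>n. (f n)\<^sup>2))"
    proof (rule integral_mono)
      fix \<omega> assume \<omega>: "\<omega> \<in> space M"
      \<comment> \<open>The bound is proved path by path, before taking expectations, and its
        right-hand side no longer depends on the path.\<close>
      have "(\<Sum>t<n. (D t \<omega>)\<^sup>2) \<le> (\<Sum>t<n. (C * card X)\<^sup>2 * learning_rate a (\<lambda>n. (f n)\<^sup>2) (\<lambda>s. Xs s \<omega>) t x b)"
      proof (rule sum_mono)
        fix t
        have "\<bar>D t \<omega>\<bar>\<^sup>2 \<le> (?lr t \<omega> * (C * card X))\<^sup>2" by (rule power_mono[OF Db'[OF \<omega>]]) simp
        then show "(D t \<omega>)\<^sup>2 \<le> (C * card X)\<^sup>2 * learning_rate a (\<lambda>n. (f n)\<^sup>2) (\<lambda>s. Xs s \<omega>) t x b"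
          by (simp add: power_mult_distrib learning_rate_power2 mult_ac)
      qed
      also have "\<dots> \<le> (C * card X)\<^sup>2 * (\<Sum>n. (f n)\<^sup>2)"
        unfolding sum_distrib_left[symmetric]
        by (intro mult_left_mono sum_learning_rate_le_suminf f) auto
      finally show "(\<Sum>t<n. (D t \<omega>)\<^sup>2) \<le> (C * card X)\<^sup>2 * (\<Sum>n. (f n)\<^sup>2)" .
    qed (use D2 in auto)
    finally show "(\<Sum>t<n. expectation (\<lambda>\<omega>. (D t \<omega>)\<^sup>2)) \<le> (C * card X)\<^sup>2 * (\<Sum>n. (f n)\<^sup>2)"
      by (simp add: prob_space)
  qed simp
  note summ = this
  show ?thesis
    unfolding D_def[symmetric]
  proof (rule martingale_increments_convergent[OF subalgebra_past past_Suc Dm Db _ summ])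
    show "expectation (\<lambda>\<omega>. G \<omega> * D t \<omega>) = 0"
      if "G \<in> borel_measurable (\<F> t)" "\<And>\<omega>. \<omega> \<in> space M \<Longrightarrow> \<bar>G \<omega>\<bar> \<le> B" for t G B
      using that by (rule orth)
  qed
qed

end

section \<open>Convergence of the iterates\<close>

context robust_Q_run
begin

abbreviation "Q t \<omega> \<equiv> Q_iter A r \<alpha> a g Q0 (\<lambda>s. Xs s \<omega>) t"
abbreviation "lr t \<omega> \<equiv> learning_rate a g (\<lambda>s. Xs s \<omega>) t"
abbreviation "emp k t \<omega> \<equiv> empirical X a (\<lambda>s. Xs s \<omega>) (\<lambda>s. Y k s \<omega>) t"

text \<open>A strong law along the random visit times. Divergence of the rates is a property of the
  individual path and therefore stays inside the almost sure statement; the only exceptional set is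
  that of the noise series.\<close>

lemma empirical_tendsto:
  assumes k: "k \<in> {1..N}" and y: "y \<in> X"
  shows "AE \<omega> in M. \<not> summable (\<lambda>t. lr t \<omega> x b) \<longrightarrow> (\<lambda>t. emp k t \<omega> x b y) \<longlonglongrightarrow> measure (p k x b) {y}"
proof -
  let ?f = "\<lambda>n. 1 / real n"
  \<comment> \<open>At \<open>n = 0\<close> division by zero yields 0, so the bounds hold there as
    well.\<close>
  have f: "0 \<le> ?f n" "?f n \<le> 1" for n by (auto simp: divide_le_eq_1)
  have f2: "summable (\<lambda>n. (?f n)\<^sup>2)"
    using inverse_power_summable[of 2, where 'a=real] by (simp add: inverse_eq_divide power_one_over)
  have K: "(\<lambda>_. k) \<in> measurable (\<F> t) (count_space {1..N})" for t using k by simp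
  have "AE \<omega> in M. convergent (\<lambda>n. \<Sum>t<n. learning_rate a ?f (\<lambda>s. Xs s \<omega>) t x b *
      (\<Sum>z\<in>X. of_bool (z = y) * (of_bool (Y k (Suc t) \<omega> = z)
         - measure (p k (Xs t \<omega>) (a t (Xs t \<omega>))) {z})))"
    by (rule noise_convergent[OF f f2 K, where C=1]) auto
  then show ?thesis
  proof eventually_elim
    case (elim \<omega>)
    let ?\<gamma> = "\<lambda>t. learning_rate a ?f (\<lambda>s. Xs s \<omega>) t x b"
    let ?\<xi> = "\<lambda>t. of_bool (Y k (Suc t) \<omega> = y) - measure (p k x b) {y}"
    \<comment> \<open>A nonzero rate means that the current pair is \<open>(x, b)\<close>, so the
      kernel at the current pair can be replaced by the fixed \<open>p k x b\<close>.\<close>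
    have eq: "?\<gamma> t * (\<Sum>z\<in>X. of_bool (z = y) * (of_bool (Y k (Suc t) \<omega> = z)
         - measure (p k (Xs t \<omega>) (a t (Xs t \<omega>))) {z})) = ?\<gamma> t * ?\<xi> t" for t
    proof (cases "?\<gamma> t = 0")
      case False
      then have "x = Xs t \<omega> \<and> b = a t (Xs t \<omega>)" by (rule learning_rate_neq_0)
      then show ?thesis using y finite_X by (simp add: of_bool_def if_distrib[of "\<lambda>c. c * _"] cong: if_cong)
    qed simp
    show ?case
    proof
      assume div: "\<not> summable (\<lambda>t. lr t \<omega> x b)"
      have unb: "\<exists>n. visits_before a (\<lambda>s. Xs s \<omega>) n x b = m" for m
        by (rule visits_unbounded[OF _ div]) (use g in simp)
      have "\<not> summable ?f" using not_summable_harmonic[where 'a=real] by (simp add: inverse_eq_divide)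
      \<comment> \<open>With infinitely many visits the rates run through the whole harmonic
        series.\<close>
      then have ns: "\<not> summable ?\<gamma>" using summable_learning_rate_imp[of ?f a "\<lambda>s. Xs s \<omega>" x b, OF f(1) _ unb] by blast
      have "(\<lambda>t. emp k t \<omega> x b y - measure (p k x b) {y}) \<longlonglongrightarrow> 0"
      proof (rule relaxation_noise_tendsto_0[OF _ _ ns])
        show "emp k (Suc t) \<omega> x b y - measure (p k x b) {y}
            = (1 - ?\<gamma> t) * (emp k t \<omega> x b y - measure (p k x b) {y}) + ?\<gamma> t * ?\<xi> t" for t
          by (rule empirical_Suc)
        show "convergent (\<lambda>n. \<Sum>t<n. ?\<gamma> t * ?\<xi> t)" using elim unfolding eq .
      qed (intro learning_rate_nonneg learning_rate_le_1 f)+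
      then show "(\<lambda>t. emp k t \<omega> x b y) \<longlonglongrightarrow> measure (p k x b) {y}" by (rule LIM_zero_cancel)
    qed
  qed
qed

text \<open>The second summand is the fixed point of B = \<open>r_max\<close> + \<alpha> B; adding
  the size of \<open>Q0\<close> covers the initial values and keeps \<open>r_max\<close> + \<alpha>
  B at most B, so the bound is preserved by every update.\<close>

definition Q_bound :: real where
  "Q_bound = (\<Sum>x\<in>X. \<Sum>b\<in>A. \<bar>Q0 x b\<bar>) + r_max / (1 - \<alpha>)"

lemma Q_bound_step: "r_max + \<alpha> * Q_bound \<le> Q_bound"
proof -
  have "r_max = (1 - \<alpha>) * (r_max / (1 - \<alpha>))" using \<alpha> by simp
  also have "\<dots> \<le> (1 - \<alpha>) * Q_bound"
    using \<alpha> unfolding Q_bound_def by (intro mult_left_mono) (auto intro!: sum_nonneg)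
  finally show ?thesis by (simp add: algebra_simps)
qed

lemma Q_bound_nonneg: "0 \<le> Q_bound"
  using \<alpha> r_max_nonneg by (auto simp: Q_bound_def intro!: add_nonneg_nonneg sum_nonneg)

lemma target_le_Q_bound:
  assumes q: "\<And>c. c \<in> A \<Longrightarrow> \<bar>q y c\<bar> \<le> Q_bound" and x: "x \<in> X" "b \<in> A" "y \<in> X"
  shows "\<bar>r x b y + \<alpha> * Max ((\<lambda>c. q y c) ` A)\<bar> \<le> Q_bound"
proof -
  have "\<bar>Max ((\<lambda>c. q y c) ` A) - Max ((\<lambda>c. 0) ` A)\<bar> \<le> Q_bound"
    using finite_A A_ne q by (intro abs_Max_image_diff_le) auto
  then have "\<bar>Max ((\<lambda>c. q y c) ` A)\<bar> \<le> Q_bound" using A_ne by (simp add: image_constant_conv)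
  then have "\<alpha> * \<bar>Max ((\<lambda>c. q y c) ` A)\<bar> \<le> \<alpha> * Q_bound" using \<alpha> by (intro mult_left_mono) auto
  then have "\<bar>\<alpha> * Max ((\<lambda>c. q y c) ` A)\<bar> \<le> \<alpha> * Q_bound" using \<alpha> by (simp add: abs_mult)
  with r_le[OF x] Q_bound_step show ?thesis by linarith
qed

lemma Q_bounded:
  assumes \<omega>: "\<omega> \<in> space M" and x: "x \<in> X" "b \<in> A"
  shows "\<bar>Q t \<omega> x b\<bar> \<le> Q_bound"
  using x
proof (induction t arbitrary: x b)
  case 0
  have "0 \<le> r_max / (1 - \<alpha>)" using \<alpha> r_max_nonneg by simp
  then show ?case using abs_le_sum_sum[OF 0, of Q0] by (simp add: Q_bound_def)
next
  case (Suc t)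
  have l: "0 \<le> lr t \<omega> x b" "lr t \<omega> x b \<le> 1"
    using g by (auto intro!: learning_rate_nonneg learning_rate_le_1)
  let ?v = "r x b (Xs (Suc t) \<omega>) + \<alpha> * Max ((\<lambda>c. Q t \<omega> (Xs (Suc t) \<omega>) c) ` A)"
  have v: "\<bar>?v\<bar> \<le> Q_bound"
    using Suc Xs_in[OF \<omega>] by (intro target_le_Q_bound) auto
  have "\<bar>Q (Suc t) \<omega> x b\<bar> \<le> \<bar>(1 - lr t \<omega> x b) * Q t \<omega> x b\<bar> + \<bar>lr t \<omega> x b * ?v\<bar>"
    by (simp add: abs_triangle_ineq)
  also have "\<dots> = (1 - lr t \<omega> x b) * \<bar>Q t \<omega> x b\<bar> + lr t \<omega> x b * \<bar>?v\<bar>"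
    using l by (simp add: abs_mult)
  also have "\<dots> \<le> (1 - lr t \<omega> x b) * Q_bound + lr t \<omega> x b * Q_bound"
    using l Suc v by (intro add_mono mult_left_mono) auto
  finally show ?case by (simp add: algebra_simps)
qed

text \<open>The pair \<open>(x, b)\<close> is fixed in the target, which makes its values at each
  \<open>y\<close> functions of the past; the rate removes the times at which another pair is
  current.\<close>

lemma Q_noise_convergent:
  assumes "summable (\<lambda>n. (g n)\<^sup>2)" and x: "x \<in> X" "b \<in> A"
  shows "AE \<omega> in M. convergent (\<lambda>n. \<Sum>t<n. lr t \<omega> x b *
      (\<Sum>y\<in>X. (r x b y + \<alpha> * Max ((\<lambda>c. Q t \<omega> y c) ` A)) * (of_bool (Xs (Suc t) \<omega> = y)
         - measure (p (\<kappa> t \<omega>) (Xs t \<omega>) (a t (Xs t \<omega>))) {y})))"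
proof -
  have "AE \<omega> in M. convergent (\<lambda>n. \<Sum>t<n. lr t \<omega> x b *
      (\<Sum>y\<in>X. (r x b y + \<alpha> * Max ((\<lambda>c. Q t \<omega> y c) ` A)) * (of_bool (Y (\<kappa> t \<omega>) (Suc t) \<omega> = y)
         - measure (p (\<kappa> t \<omega>) (Xs t \<omega>) (a t (Xs t \<omega>))) {y})))"
  proof (rule noise_convergent[where C=Q_bound])
    fix t y
    show "(\<lambda>\<omega>. r x b y + \<alpha> * Max ((\<lambda>c. Q t \<omega> y c) ` A)) \<in> borel_measurable (\<F> t)"
    proof (rule path_functional_past[where f="\<lambda>\<xi>. r x b y + \<alpha> * Max ((\<lambda>c. Q_iter A r \<alpha> a g Q0 \<xi> t y c) ` A)"])
      fix \<xi> \<xi>' :: "nat \<Rightarrow> 'x" assume "\<And>s. s \<le> t \<Longrightarrow> \<xi> s = \<xi>' s"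
      then have "Q_iter A r \<alpha> a g Q0 \<xi> t = Q_iter A r \<alpha> a g Q0 \<xi>' t" by (rule Q_iter_cong)
      then show "r x b y + \<alpha> * Max ((\<lambda>c. Q_iter A r \<alpha> a g Q0 \<xi> t y c) ` A)
          = r x b y + \<alpha> * Max ((\<lambda>c. Q_iter A r \<alpha> a g Q0 \<xi>' t y c) ` A)" by simp
    qed
  next
    fix t y \<omega> assume "y \<in> X" "\<omega> \<in> space M"
    then show "\<bar>r x b y + \<alpha> * Max ((\<lambda>c. Q t \<omega> y c) ` A)\<bar> \<le> Q_bound"
      using Q_bounded x by (intro target_le_Q_bound) auto
  qed (use g assms \<kappa>_past in auto)
  then show ?thesis
    using AE_space by eventually_elim (simp add: Xs_Suc)
qed

text \<open>
  \<open>\<kappa> t\<close> minimizes the empirical cost, so the estimation error enters twice: for \<open>\<kappa> t\<close> itself and for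
  the true minimizer.
\<close>

lemma selection_error_le:
  assumes \<omega>: "\<omega> \<in> space M" and x: "x = Xs t \<omega>" "b = a t (Xs t \<omega>)"
  shows "\<bar>selection_cost X A r \<alpha> (Q t \<omega>) x b (\<lambda>y. measure (p (\<kappa> t \<omega>) x b) {y}) - bellman (Q t \<omega>) x b\<bar>
     \<le> 2 * (Q_bound * (\<Sum>k\<in>{1..N}. \<Sum>y\<in>X. \<bar>emp k t \<omega> x b y - measure (p k x b) {y}\<bar>))"
proof -
  have xX: "x \<in> X" "b \<in> A" using x Xs_in[OF \<omega>] a_in by auto
  let ?c = "selection_cost X A r \<alpha> (Q t \<omega>) x b"
  let ?m = "\<lambda>k y. measure (p k x b) {y}"
  let ?e = "\<lambda>k. emp k t \<omega> x b"
  define d where "d = Q_bound * (\<Sum>k\<in>{1..N}. \<Sum>y\<in>X. \<bar>?e k y - ?m k y\<bar>)"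
  have diff: "\<bar>?c (?e k) - ?c (?m k)\<bar> \<le> d" if k: "k \<in> {1..N}" for k
  proof -
    have eq: "?c (?e k) - ?c (?m k) = (\<Sum>y\<in>X. (r x b y + \<alpha> * Max ((\<lambda>c. Q t \<omega> y c) ` A)) * (?e k y - ?m k y))"
      unfolding selection_cost_def by (simp add: sum_subtractf right_diff_distrib)
    have "\<bar>?c (?e k) - ?c (?m k)\<bar> \<le> (\<Sum>y\<in>X. Q_bound * \<bar>?e k y - ?m k y\<bar>)"
      unfolding eq
    proof (rule order_trans[OF sum_abs sum_mono])
      fix y assume "y \<in> X"
      then have "\<bar>r x b y + \<alpha> * Max ((\<lambda>c. Q t \<omega> y c) ` A)\<bar> \<le> Q_bound"
        using Q_bounded[OF \<omega>] xX by (intro target_le_Q_bound) auto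
      then show "\<bar>(r x b y + \<alpha> * Max ((\<lambda>c. Q t \<omega> y c) ` A)) * (?e k y - ?m k y)\<bar> \<le> Q_bound * \<bar>?e k y - ?m k y\<bar>"
        unfolding abs_mult by (rule mult_right_mono) simp
    qed
    also have "\<dots> = Q_bound * (\<Sum>y\<in>X. \<bar>?e k y - ?m k y\<bar>)" by (simp add: sum_distrib_left)
    also have "\<dots> \<le> d"
      unfolding d_def using k Q_bound_nonneg
      by (intro mult_left_mono member_le_sum[where f="\<lambda>k. \<Sum>y\<in>X. \<bar>?e k y - ?m k y\<bar>"]) (auto intro: sum_nonneg)
    finally show ?thesis .
  qed
  have opt: "?c (?e (\<kappa> t \<omega>)) \<le> ?c (?e k)" if "k \<in> {1..N}" for k
    using run \<omega> that unfolding robust_Q_learning_def is_arg_min_linorder x by blast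
  obtain k where k: "k \<in> {1..N}" "bellman (Q t \<omega>) x b = ?c (?m k)"
  proof -
    have "bellman (Q t \<omega>) x b \<in> (\<lambda>k. ?c (?m k)) ` {1..N}"
      unfolding bellman_def using N by (intro Min_in) auto
    then show ?thesis using that by blast
  qed
  have "bellman (Q t \<omega>) x b \<le> ?c (?m (\<kappa> t \<omega>))"
    unfolding bellman_def using \<kappa>_in[OF \<omega>] by (intro Min_le) auto
  moreover have "?c (?m (\<kappa> t \<omega>)) \<le> ?c (?m k) + 2 * d"
    using diff[OF k(1)] diff[OF \<kappa>_in[OF \<omega>, of t]] opt[OF k(1)] by linarith
  ultimately show ?thesis unfolding d_def[symmetric] k(2) by linarith
qed

abbreviation "Qs \<equiv> robust_Q X A r \<alpha> N p"

text \<open>The deterministic core: on one path, divergent rates, consistent estimates and a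
  convergent noise series already force convergence.\<close>

lemma Q_tendsto_path:
  assumes \<omega>: "\<omega> \<in> space M"
    and ns: "\<And>x b. x \<in> X \<Longrightarrow> b \<in> A \<Longrightarrow> \<not> summable (\<lambda>t. lr t \<omega> x b)"
    and emp: "\<And>k x b y. k \<in> {1..N} \<Longrightarrow> x \<in> X \<Longrightarrow> b \<in> A \<Longrightarrow> y \<in> X \<Longrightarrow>
      (\<lambda>t. emp k t \<omega> x b y) \<longlonglongrightarrow> measure (p k x b) {y}"
    and noise: "\<And>x b. x \<in> X \<Longrightarrow> b \<in> A \<Longrightarrow> convergent (\<lambda>n. \<Sum>t<n. lr t \<omega> x b *
      (\<Sum>y\<in>X. (r x b y + \<alpha> * Max ((\<lambda>c. Q t \<omega> y c) ` A)) * (of_bool (Xs (Suc t) \<omega> = y)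
         - measure (p (\<kappa> t \<omega>) (Xs t \<omega>) (a t (Xs t \<omega>))) {y})))"
    and x: "x \<in> X" "b \<in> A"
  shows "(\<lambda>t. Q t \<omega> x b) \<longlonglongrightarrow> Qs x b"
proof -
  define v where "v t x b y = r x b y + \<alpha> * Max ((\<lambda>c. Q t \<omega> y c) ` A)" for t x b y
  define m where "m t y = measure (p (\<kappa> t \<omega>) (Xs t \<omega>) (a t (Xs t \<omega>))) {y}" for t y
  define \<xi> where "\<xi> t s = (\<Sum>y\<in>X. v t (fst s) (snd s) y * (of_bool (Xs (Suc t) \<omega> = y) - m t y))" for t s
  \<comment> \<open>The index \<open>\<kappa> t\<close> is selected for the current pair only, so at
    other pairs its cost need not be close to the minimum. Setting the error to 0 there is harmless,
    since the rate is 0, and makes it tend to 0 at every pair.\<close>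
  define err where "err t s = (if s = (Xs t \<omega>, a t (Xs t \<omega>))
    then selection_cost X A r \<alpha> (Q t \<omega>) (fst s) (snd s) (m t) - bellman (Q t \<omega>) (fst s) (snd s) else 0)" for t s
  have "(\<lambda>t. (\<lambda>s. Q t \<omega> (fst s) (snd s) - Qs (fst s) (snd s)) (x, b)) \<longlonglongrightarrow> 0"
  proof (rule stochastic_approximation_tendsto_0[where S="X \<times> A" and \<alpha>=\<alpha>
        and \<gamma>="\<lambda>t s. lr t \<omega> (fst s) (snd s)" and \<xi>=\<xi> and e=err
        and F="\<lambda>t s. bellman (Q t \<omega>) (fst s) (snd s) - Qs (fst s) (snd s)"
        and ?B0.0="Q_bound + (\<Sum>x\<in>X. \<Sum>b\<in>A. \<bar>Qs x b\<bar>)"])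
    show "finite (X \<times> A)" using finite_X finite_A by simp
    show "0 \<le> \<alpha>" "\<alpha> < 1" using \<alpha> by auto
    show "(x, b) \<in> X \<times> A" using x by simp
  next
    fix s assume s: "s \<in> X \<times> A"
    then obtain x b where sx: "s = (x, b)" and x: "x \<in> X" "b \<in> A" by auto
    show "0 \<le> lr t \<omega> (fst s) (snd s)" "lr t \<omega> (fst s) (snd s) \<le> 1" for t
      using g by (auto intro!: learning_rate_nonneg learning_rate_le_1)
    show "\<not> summable (\<lambda>t. lr t \<omega> (fst s) (snd s))" using ns x sx by simp
    show "convergent (\<lambda>n. \<Sum>t<n. lr t \<omega> (fst s) (snd s) * \<xi> t s)"
      using noise[OF x] by (simp add: \<xi>_def v_def m_def sx)
    show "\<bar>Q t \<omega> (fst s) (snd s) - Qs (fst s) (snd s)\<bar> \<le> Q_bound + (\<Sum>x\<in>X. \<Sum>b\<in>A. \<bar>Qs x b\<bar>)" for t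
      using Q_bounded[OF \<omega> x, of t] abs_le_sum_sum[OF x, of Qs] unfolding sx by simp
    show "\<bar>bellman (Q t \<omega>) (fst s) (snd s) - Qs (fst s) (snd s)\<bar> \<le> \<alpha> * B"
      if "\<And>s'. s' \<in> X \<times> A \<Longrightarrow> \<bar>Q t \<omega> (fst s') (snd s') - Qs (fst s') (snd s')\<bar> \<le> B" for t B
    proof -
      have "\<bar>Q t \<omega> y c - Qs y c\<bar> \<le> B" if "y \<in> X" "c \<in> A" for y c
        using \<open>\<And>s'. s' \<in> X \<times> A \<Longrightarrow> \<bar>Q t \<omega> (fst s') (snd s') - Qs (fst s') (snd s')\<bar> \<le> B\<close>[of "(y, c)"] that by simp
      from bellman_contraction[of "Q t \<omega>" Qs B x b, OF this x] show ?thesis by (simp add: sx bellman_robust_Q x)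
    qed
    show "(\<lambda>t. err t s) \<longlonglongrightarrow> 0"
    proof (rule Lim_null_comparison)
      show "(\<lambda>t. 2 * (Q_bound * (\<Sum>k\<in>{1..N}. \<Sum>y\<in>X. \<bar>emp k t \<omega> x b y - measure (p k x b) {y}\<bar>))) \<longlonglongrightarrow> 0"
        by (intro tendsto_mult_right_zero tendsto_null_sum tendsto_rabs_zero LIM_zero emp x)
      have "\<bar>err t s\<bar> \<le> 2 * (Q_bound * (\<Sum>k\<in>{1..N}. \<Sum>y\<in>X. \<bar>emp k t \<omega> x b y - measure (p k x b) {y}\<bar>))" for t
      proof (cases "s = (Xs t \<omega>, a t (Xs t \<omega>))")
        case True
        then have xb: "x = Xs t \<omega>" "b = a t (Xs t \<omega>)" by (simp_all add: sx)
        have "err t s = selection_cost X A r \<alpha> (Q t \<omega>) x b (\<lambda>y. measure (p (\<kappa> t \<omega>) x b) {y})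
            - bellman (Q t \<omega>) x b"
          unfolding err_def m_def[abs_def] sx using xb by simp
        then show ?thesis using selection_error_le[OF \<omega> xb] by (simp only:)
      next
        case False
        then have "err t s = 0" by (simp add: err_def)
        then show ?thesis using Q_bound_nonneg by (auto intro!: mult_nonneg_nonneg sum_nonneg)
      qed
      then show "\<forall>\<^sub>F t in sequentially. norm (err t s)
          \<le> 2 * (Q_bound * (\<Sum>k\<in>{1..N}. \<Sum>y\<in>X. \<bar>emp k t \<omega> x b y - measure (p k x b) {y}\<bar>))"
        by (intro always_eventually) auto
    qed
    show "Q (Suc t) \<omega> (fst s) (snd s) - Qs (fst s) (snd s)
        = (1 - lr t \<omega> (fst s) (snd s)) * (Q t \<omega> (fst s) (snd s) - Qs (fst s) (snd s))
          + lr t \<omega> (fst s) (snd s) * (bellman (Q t \<omega>) (fst s) (snd s) - Qs (fst s) (snd s) + \<xi> t s + err t s)" for t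
    proof (cases "lr t \<omega> x b = 0")
      case True
      then show ?thesis by (simp add: sx)
    next
      case False
      then have st: "s = (Xs t \<omega>, a t (Xs t \<omega>))" using learning_rate_neq_0[OF False] by (simp add: sx)
      have "\<xi> t s = (\<Sum>y\<in>X. v t x b y * of_bool (Xs (Suc t) \<omega> = y)) - (\<Sum>y\<in>X. v t x b y * m t y)"
        unfolding \<xi>_def sx by (simp add: right_diff_distrib sum_subtractf)
      also have "(\<Sum>y\<in>X. v t x b y * of_bool (Xs (Suc t) \<omega> = y)) = v t x b (Xs (Suc t) \<omega>)"
        using finite_X Xs_in[OF \<omega>, of "Suc t"] by (simp add: of_bool_def if_distrib[of "\<lambda>c. _ * c"] cong: if_cong)
      finally have \<xi>: "\<xi> t s = v t x b (Xs (Suc t) \<omega>) - selection_cost X A r \<alpha> (Q t \<omega>) x b (m t)"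
        by (simp add: selection_cost_def v_def)
      have "err t s = selection_cost X A r \<alpha> (Q t \<omega>) x b (m t) - bellman (Q t \<omega>) x b"
        using st by (simp add: err_def sx)
      \<comment> \<open>The Bellman value cancels between the drift and the error, and the cost of
        the selected kernel between the error and the noise; the update target minus the fixed point
        remains.\<close>
      with \<xi> have sum: "bellman (Q t \<omega>) x b - Qs x b + \<xi> t s + err t s = v t x b (Xs (Suc t) \<omega>) - Qs x b" by simp
      show ?thesis unfolding sx fst_conv snd_conv sum[unfolded sx] by (simp add: v_def algebra_simps)
    qed
  qed
  then have "(\<lambda>t. Q t \<omega> x b - Qs x b) \<longlonglongrightarrow> 0" by simp
  then show ?thesis by (rule LIM_zero_cancel)
qed

lemma Q_tendsto:
  assumes rates: "AE \<omega> in M. \<forall>x\<in>X. \<forall>b\<in>A.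
           (\<Sum>t. ennreal (lr t \<omega> x b)) = \<infinity> \<and> (\<Sum>t. ennreal ((lr t \<omega> x b)\<^sup>2)) < \<infinity>"
  shows "AE \<omega> in M. \<forall>x\<in>X. \<forall>b\<in>A. (\<lambda>t. Q t \<omega> x b) \<longlonglongrightarrow> Qs x b"
proof -
  have lr0: "0 \<le> lr t \<omega> x b" for t \<omega> x b using g by (auto intro!: learning_rate_nonneg)
  have ns: "AE \<omega> in M. \<forall>x\<in>X. \<forall>b\<in>A. \<not> summable (\<lambda>t. lr t \<omega> x b) \<and> summable (\<lambda>t. (lr t \<omega> x b)\<^sup>2)"
    using rates
  proof eventually_elim
    case (elim \<omega>)
    show ?case
    proof (intro ballI conjI)
      fix x b assume x: "x \<in> X" "b \<in> A"
      have inf: "(\<Sum>t. ennreal (lr t \<omega> x b)) = top" "(\<Sum>t. ennreal ((lr t \<omega> x b)\<^sup>2)) \<noteq> top"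
        using elim x unfolding infinity_ennreal_def by (blast, metis less_irrefl)
      show "\<not> summable (\<lambda>t. lr t \<omega> x b)"
        using ennreal_suminf_neq_top[of "\<lambda>t. lr t \<omega> x b", OF _ lr0] inf(1) by blast
      show "summable (\<lambda>t. (lr t \<omega> x b)\<^sup>2)"
        by (rule summable_suminf_not_top[OF zero_le_power2 inf(2)])
    qed
  qed
  text \<open>On a path visiting every pair infinitely often the random series \<open>\<Sum>\<^sub>t \<gamma>\<^sub>t\<^sup>2\<close> runs through all
    of \<open>g 1, g 2, \<dots>\<close>, which bounds it uniformly over all paths.\<close>
  have "summable (\<lambda>n. (g n)\<^sup>2)"
  proof (rule ccontr)
    assume not: "\<not> summable (\<lambda>n. (g n)\<^sup>2)"
    obtain x b where x: "x \<in> X" "b \<in> A" using X_ne A_ne by auto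
    \<comment> \<open>Summability of the squares of \<open>g\<close> does not involve the path, so a
      single good path would contradict its failure, and in a probability space almost every path is
      good.\<close>
    have "AE \<omega> in M. False"
      using ns
    proof eventually_elim
      case (elim \<omega>)
      then have *: "\<not> summable (\<lambda>t. lr t \<omega> x b)" "summable (\<lambda>t. (lr t \<omega> x b)\<^sup>2)" using x by auto
      have unb: "\<exists>n. visits_before a (\<lambda>s. Xs s \<omega>) n x b = m" for m
        by (rule visits_unbounded[OF _ *(1)]) (use g in simp)
      have "summable (\<lambda>n. (g n)\<^sup>2)"
        by (rule summable_learning_rate_imp[OF _ *(2)[unfolded learning_rate_power2] unb]) simp
      with not show False ..
    qed
    then show False by simp
  qed
  then have "AE \<omega> in M. \<forall>s\<in>X \<times> A. convergent (\<lambda>n. \<Sum>t<n. lr t \<omega> (fst s) (snd s) *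
      (\<Sum>y\<in>X. (r (fst s) (snd s) y + \<alpha> * Max ((\<lambda>c. Q t \<omega> y c) ` A)) * (of_bool (Xs (Suc t) \<omega> = y)
         - measure (p (\<kappa> t \<omega>) (Xs t \<omega>) (a t (Xs t \<omega>))) {y})))"
    using finite_X finite_A by (intro AE_finite_allI) (auto intro: Q_noise_convergent)
  moreover have "AE \<omega> in M. \<forall>(k, x, b, y)\<in>{1..N} \<times> X \<times> A \<times> X. \<not> summable (\<lambda>t. lr t \<omega> x b) \<longrightarrow>
      (\<lambda>t. emp k t \<omega> x b y) \<longlonglongrightarrow> measure (p k x b) {y}"
    using finite_X finite_A by (intro AE_finite_allI) (auto intro: empirical_tendsto)
  ultimately show ?thesis
    using ns AE_space
  proof eventually_elim
    case (elim \<omega>)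
    have ns: "\<not> summable (\<lambda>t. lr t \<omega> x b)" if "x \<in> X" "b \<in> A" for x b using elim(3) that by blast
    show ?case
    proof (intro ballI Q_tendsto_path[OF elim(4) ns])
      show "(\<lambda>t. emp k t \<omega> x b y) \<longlonglongrightarrow> measure (p k x b) {y}"
        if "k \<in> {1..N}" "x \<in> X" "b \<in> A" "y \<in> X" for k x b y
        using elim(2) ns that by fast
    qed (use elim(1) in force)+
  qed
qed

end

theorem theorem3p1:
  fixes X :: "(real ^ 'd) set" and A :: "(real ^ 'm) set"
    and r :: "real ^ 'd \<Rightarrow> real ^ 'm \<Rightarrow> real ^ 'd \<Rightarrow> real"
    and \<alpha> :: real and N :: nat
    and p :: "nat \<Rightarrow> real ^ 'd \<Rightarrow> real ^ 'm \<Rightarrow> (real ^ 'd) measure"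
    and g :: "nat \<Rightarrow> real" and x0 :: "real ^ 'd"
    and a :: "nat \<Rightarrow> real ^ 'd \<Rightarrow> real ^ 'm"
    and Q0 :: "real ^ 'd \<Rightarrow> real ^ 'm \<Rightarrow> real"
    and M :: "'w measure"
    and Xs :: "nat \<Rightarrow> 'w \<Rightarrow> real ^ 'd"
    and Y :: "nat \<Rightarrow> nat \<Rightarrow> 'w \<Rightarrow> real ^ 'd"
    and \<kappa> :: "nat \<Rightarrow> 'w \<Rightarrow> nat"
  assumes "finite X" "X \<noteq> {}" "finite A" "A \<noteq> {}"
    and "N \<ge> 1"
    and "\<And>k x b. k \<in> {1..N} \<Longrightarrow> x \<in> X \<Longrightarrow> b \<in> A \<Longrightarrow> p k x b \<in> space (prob_algebra (count_space X))"
    and "0 < \<alpha>" "\<alpha> < 1"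
    and "\<And>n. g n \<in> {0..1}"
    and "x0 \<in> X" "a \<in> policies X A"
    and "robust_Q_learning X A r \<alpha> N p x0 a g Q0 M Xs Y \<kappa>"
    and "AE \<omega> in M. \<forall>x\<in>X. \<forall>b\<in>A.
           (\<Sum>t. ennreal (learning_rate a g (\<lambda>s. Xs s \<omega>) t x b)) = \<infinity>
           \<and> (\<Sum>t. ennreal ((learning_rate a g (\<lambda>s. Xs s \<omega>) t x b)\<^sup>2)) < \<infinity>"
  shows "\<forall>x\<in>X. \<forall>b\<in>A. AE \<omega> in M.
           (\<lambda>t. Q_iter A r \<alpha> a g Q0 (\<lambda>s. Xs s \<omega>) t x b) \<longlonglongrightarrow> robust_Q X A r \<alpha> N p x b"
proof -
  interpret robust_Q_run X A r \<alpha> N p x0 a g Q0 M Xs Y \<kappa>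
    by (intro robust_Q_run.intro robust_mdp.intro robust_Q_run_axioms.intro assms)
  have lim: "AE \<omega> in M. \<forall>x\<in>X. \<forall>b\<in>A.
      (\<lambda>t. Q_iter A r \<alpha> a g Q0 (\<lambda>s. Xs s \<omega>) t x b) \<longlonglongrightarrow> robust_Q X A r \<alpha> N p x b"
    using assms(13) by (rule Q_tendsto)
  show ?thesis
  proof (intro ballI)
    fix x b assume "x \<in> X" "b \<in> A"
    with lim show "AE \<omega> in M. (\<lambda>t. Q_iter A r \<alpha> a g Q0 (\<lambda>s. Xs s \<omega>) t x b) \<longlonglongrightarrow> robust_Q X A r \<alpha> N p x b"
      by (elim eventually_mono) blast
  qed
qed

end
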